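(* Let $S,I:\mathbb{R}\to\mathbb{R}$ be $2\pi$-periodic Lipschitz functions and suppose there are $\alpha_0\in(0,\pi)$, $p,q\ge1$, $c_1,c_2>0$, $c_3\in(0,1]$, $c_4>0$, $I_*>0$ such that: $S(\theta)\le-c_1(\pi-\theta)^p$ for $\theta\in[\alpha_0,\pi]$ and $S(\theta)\ge c_1(\theta+\pi)^p$ for $\theta\in[-\pi,-\alpha_0]$; $0\le I(\theta)\le c_2(\pi-|\theta|)^q$ for $\theta\in[-\pi,\pi]$; $\min_{|\phi|\le\max\{|\theta|,\alpha_0\}}I(\phi)\ge c_3I(\theta)$ for $\theta\in[-\pi,\pi]$; $S'(\theta)\ge c_4(I_*-I(\theta))$ for all $\theta$; $I'(\theta)S(\theta)\ge0$ for all $\theta$; and $I(\theta)>0$ for all $\theta\in(-\pi,\pi)$. Let $\omega_1,\dots,\omega_N\in\mathbb{R}$, $\|\Omega\|_\infty=\max_i|\omega_i|$, and assume \[ \kappa>\max\left\{\frac{2(2c_2)^{p/q}}{c_1c_3}\cdot\frac{\|\Omega\|_\infty}{I_*^{1+p/q}},\ \frac{2}{c_1c_3(\pi-\alpha_0)^p}\cdot\frac{\|\Omega\|_\infty}{I_*}\right\}. \] Then for Lebesgue almost every initial data $\Theta^0\in\mathbb{R}^N$, the solution of $\dot\theta_i=\omega_i+\frac{\kappa}{N}\sum_{j=1}^NI(\theta_j)S(\theta_i)$, $\theta_i(0)=\theta_i^0$, with $R(t)=\frac1N\sum_jI(\theta_j(t))$, satisfies (a) $\liminf_{t\to\infty}R(t)>\frac{c_3I_*}{2}$;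 (b) $\limsup_{t\to\infty}\theta_i(t)-\liminf_{t\to\infty}\theta_i(t)<2\pi$ for all $i=1,\dots,N$.
   Context: $S'$ and $I'$ denote derivatives (the conditions presuppose differentiability). *)

theory Defs
  imports "HOL-Analysis.Analysis"
begin

definition sup_norm :: "real ^ 'n \<Rightarrow> real" where
  "sup_norm w = Max (range (\<lambda>i. \<bar>w $ i\<bar>))"

definition kur_field ::
  "(real \<Rightarrow> real) \<Rightarrow> (real \<Rightarrow> real) \<Rightarrow> real ^ 'n \<Rightarrow> real \<Rightarrow> real ^ 'n \<Rightarrow> real ^ 'n" where
  "kur_field S I w \<kappa> x =
     (\<chi> i. w $ i + \<kappa> / real CARD('n) * (\<Sum>j\<in>UNIV. I (x $ j)) * S (x $ i))"

definition order_R :: "(real \<Rightarrow> real) \<Rightarrow> real ^ 'n \<Rightarrow> real" where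
  "order_R I x = (\<Sum>j\<in>UNIV. I (x $ j)) / real CARD('n)"

end

theory Submission
  imports Defs
begin

text \<open>
  Fix a level \<open>r < Istar\<close> close to \<open>Istar\<close> and let \<open>B\<close> be the set of initial data from which some
  solution has order parameter \<open>R \<le> r\<close> for all times. The divergence of the field is at least
  \<open>\<kappa> c4 N R (Istar - R)\<close>, which is nonnegative near \<open>B\<close>, while \<open>B\<close> is forward invariant and periodic,
  hence of finite volume modulo periods. So \<open>R = 0\<close> almost everywhere on \<open>B\<close>, and \<open>B\<close> is a null set.
  Since \<open>S\<close> and \<open>I\<close> need not be \<open>C\<^sup>1\<close>, this is not argued through the Jacobian of the flow, but with
  Euler steps \<open>x \<mapsto> x + h F x\<close>, to which the change of variables formula applies directly.

  Off \<open>B\<close>, at some time \<open>R\<close> exceeds \<open>r\<close>. The oscillators with \<open>I(\<theta>\<^sub>j)\<close> roughly above \<open>Istar / 2\<close> then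
  contribute more than \<open>Istar / 2\<close> to \<open>R\<close>; they are trapped between barriers as long as
  \<open>R \<ge> c3 Istar / 2\<close>, and while trapped they keep \<open>R\<close> strictly above \<open>c3 Istar / 2\<close>. Once this
  holds forever, the arc \<open>|\<theta>| \<le> \<alpha>0\<close> traps every oscillator that enters it, so each phase
  finally stays in that arc or in its complement.
\<close>

subsection \<open>A well-ordered index type\<close>

text \<open>The change of variables theorem of the library requires a well-ordered index type, so the
  volume argument is carried out over this type of the same cardinality as \<open>'a\<close>.\<close>
typedef (overloaded) 'a enum_index = "{..<CARD('a::finite)}"
  by (auto intro: exI[of _ 0])

instance enum_index :: (finite) finite
proof
  show "finite (UNIV :: 'a enum_index set)"
    using finite_imageD[of Rep_enum_index UNIV] Rep_enum_index
    by (metis Rep_enum_index_inject finite_lessThan finite_subset image_subset_iff inj_onI)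
qed

instantiation enum_index :: (finite) linorder
begin
definition "x \<le> y \<longleftrightarrow> Rep_enum_index x \<le> Rep_enum_index y"
definition "x < y \<longleftrightarrow> Rep_enum_index x < Rep_enum_index y"
instance
  by standard (auto simp: less_eq_enum_index_def less_enum_index_def Rep_enum_index_inject)
end

instance enum_index :: (finite) wellorder
proof
  fix P :: "'a enum_index \<Rightarrow> bool" and a
  assume step: "\<And>x. (\<And>y. y < x \<Longrightarrow> P y) \<Longrightarrow> P x"
  show "P a"
    by (induction a rule: measure_induct_rule[of Rep_enum_index])
      (auto intro: step simp: less_enum_index_def)
qed

lemma enum_index_bij:
  obtains f :: "'a::finite \<Rightarrow> 'a enum_index" where "bij f"
proof -
  have "CARD('a enum_index) = CARD('a)"
    using type_definition.card[OF type_definition_enum_index] by simp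
  then show ?thesis
    using that finite_same_card_bij[of "UNIV :: 'a set" "UNIV :: 'a enum_index set"] by auto
qed

subsection \<open>Volume growth of Euler steps\<close>

text \<open>In the Leibniz expansion the identity permutation contributes the product of the
  diagonal entries, which produces the trace. Every other permutation moves at least two indices, so
  it carries two factors \<open>h\<close> and goes into the quadratic error.\<close>

lemma det_mat_1_plus_scaleR_ge:
  fixes A :: "real^'n^'n"
  assumes A: "\<And>i j. \<bar>A $ i $ j\<bar> \<le> K" and h: "0 \<le> h" "h \<le> 1" "h * K \<le> 1 / 2"
  shows "det (mat 1 + h *\<^sub>R A) \<ge>
    1 + h * trace A - (2 * real CARD('n) * K\<^sup>2 + fact CARD('n) * (1 + K) ^ CARD('n)) * h\<^sup>2"
proof -
  let ?P = "{p :: 'n \<Rightarrow> 'n. p permutes UNIV}"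
  let ?M = "mat 1 + h *\<^sub>R A"
  let ?t = "\<lambda>p. of_int (sign p) * (\<Prod>i\<in>UNIV. ?M $ i $ p i)"
  have K: "0 \<le> K" using A[of undefined undefined] by linarith
  have M: "?M $ i $ j = (if i = j then 1 else 0) + h * A $ i $ j" for i j
    by (simp add: mat_def)
  have hA: "\<bar>h * A $ i $ j\<bar> \<le> h * K" for i j
    using A[of i j] h by (simp add: abs_mult mult_left_mono)
  have diag: "?t id \<ge> 1 + h * trace A - 2 * real CARD('n) * K\<^sup>2 * h\<^sup>2"
  proof -
    \<comment> \<open>From \<open>\<bar>ln (1 + x) - x\<bar> \<le> 2 * x\<^sup>2\<close> for
      \<open>\<bar>x\<bar> \<le> 1 / 2\<close>. Exponentials turn the diagonal product into the
      exponential of a sum, where the trace appears.\<close>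
    have "exp (h * A $ i $ i - 2 * (h * K)\<^sup>2) \<le> 1 + h * A $ i $ i" for i
    proof -
      define x where "x = h * A $ i $ i"
      have x: "\<bar>x\<bar> \<le> h * K" "\<bar>x\<bar> \<le> 1 / 2" using hA[of i i] h unfolding x_def by linarith+
      have "x\<^sup>2 \<le> (h * K)\<^sup>2" using x by (metis abs_ge_zero power2_abs power_mono)
      then have "x - 2 * (h * K)\<^sup>2 \<le> ln (1 + x)"
        using abs_ln_one_plus_x_minus_x_bound[of x] x by linarith
      then have "exp (x - 2 * (h * K)\<^sup>2) \<le> exp (ln (1 + x))" by simp
      then show ?thesis using x unfolding x_def[symmetric] by simp
    qed
    then have "(\<Prod>i\<in>UNIV. exp (h * A $ i $ i - 2 * (h * K)\<^sup>2)) \<le> (\<Prod>i\<in>UNIV. 1 + h * A $ i $ i)"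
      by (intro prod_mono) auto
    moreover have "(\<Prod>i\<in>UNIV. exp (h * A $ i $ i - 2 * (h * K)\<^sup>2))
        = exp (h * trace A - 2 * real CARD('n) * K\<^sup>2 * h\<^sup>2)"
      by (simp add: exp_sum[symmetric] trace_def sum_subtractf sum_distrib_left power_mult_distrib algebra_simps)
    moreover have "?t id = (\<Prod>i\<in>UNIV. 1 + h * A $ i $ i)"
      by (simp add: mat_def)
    ultimately show ?thesis
      using exp_ge_add_one_self[of "h * trace A - 2 * real CARD('n) * K\<^sup>2 * h\<^sup>2"] by linarith
  qed
  have off: "\<bar>?t p\<bar> \<le> (1 + K) ^ CARD('n) * h\<^sup>2" if p: "p \<in> ?P" "p \<noteq> id" for p
  proof -
    let ?m = "{i. p i \<noteq> i}"
    obtain i where i: "p i \<noteq> i" using p by (auto simp: fun_eq_iff)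
    \<comment> \<open>By injectivity the image of a moved index is moved too, so \<open>i\<close>
      and \<open>p i\<close> are two distinct moved indices.\<close>
    have "p (p i) \<noteq> p i" using p(1) i by (metis mem_Collect_eq permutes_def)
    then have "card {i, p i} \<le> card ?m" using i by (intro card_mono) auto
    then have m: "2 \<le> card ?m" using i by auto
    have "\<bar>?t p\<bar> = (\<Prod>i\<in>UNIV. \<bar>?M $ i $ p i\<bar>)"
      by (simp add: abs_mult abs_prod sign_def)
    also have "\<dots> \<le> (\<Prod>i\<in>UNIV. (1 + K) * (if p i \<noteq> i then h else 1))"
    proof (intro prod_mono conjI)
      fix i
      have "h * K \<le> 1 * K" using K h by (intro mult_right_mono) auto
      then show "\<bar>?M $ i $ p i\<bar> \<le> (1 + K) * (if p i \<noteq> i then h else 1)"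
        using hA[of i "p i"] h K unfolding M by (auto simp: algebra_simps)
    qed auto
    also have "\<dots> = (1 + K) ^ CARD('n) * h ^ card ?m"
      by (simp add: prod.distrib prod.If_cases)
    also have "\<dots> \<le> (1 + K) ^ CARD('n) * h\<^sup>2"
      using K h m by (intro mult_left_mono power_decreasing) auto
    finally show ?thesis .
  qed
  have fin: "finite ?P" by (simp add: finite_permutations)
  have id: "id \<in> ?P" by (simp add: permutes_id)
  have "\<bar>\<Sum>p\<in>?P - {id}. ?t p\<bar> \<le> (\<Sum>p\<in>?P - {id}. (1 + K) ^ CARD('n) * h\<^sup>2)"
    using off by (intro order_trans[OF sum_abs] sum_mono) auto
  also have "\<dots> \<le> (\<Sum>p\<in>?P. (1 + K) ^ CARD('n) * h\<^sup>2)"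
    using fin K by (intro sum_mono2) auto
  also have "\<dots> = fact CARD('n) * ((1 + K) ^ CARD('n) * h\<^sup>2)"
    by (simp add: card_permutations[of UNIV "CARD('n)"])
  finally have "(\<Sum>p\<in>?P - {id}. ?t p) \<ge> - (fact CARD('n) * ((1 + K) ^ CARD('n) * h\<^sup>2))"
    by linarith
  moreover have "det ?M = ?t id + (\<Sum>p\<in>?P - {id}. ?t p)"
    unfolding det_def using fin id by (subst sum.remove[of _ id]) auto
  ultimately show ?thesis using diag by (simp add: algebra_simps)
qed

text \<open>Compare \<open>D\<close> with the difference quotient along a short multiple of
  \<open>v\<close>. This bounds the Jacobian entries of an Euler step using the Lipschitz constant
  alone.\<close>

lemma lipschitz_on_has_derivative_norm_le:
  fixes f :: "'a::real_normed_vector \<Rightarrow> 'b::real_normed_vector"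
  assumes "L-lipschitz_on UNIV f" and D: "(f has_derivative D) (at x)"
  shows "norm (D v) \<le> L * norm v"
proof (cases "v = 0")
  case True
  then show ?thesis using has_derivative_linear[OF D, THEN linear_0] by simp
next
  case False
  have bound: "norm (D v) \<le> L * norm v + e * norm v" if "e > 0" for e
  proof -
    obtain d where "d > 0"
      and d: "\<And>y. norm (y - x) < d \<Longrightarrow> norm (f y - f x - D (y - x)) \<le> e * norm (y - x)"
      using D \<open>e > 0\<close> unfolding has_derivative_at_alt by blast
    define t where "t = d / (2 * norm v)"
    have t: "t > 0" "norm (t *\<^sub>R v) < d" using \<open>d > 0\<close> False by (auto simp: t_def)
    have "norm (D (t *\<^sub>R v)) \<le> norm (f (x + t *\<^sub>R v) - f x) + norm (f (x + t *\<^sub>R v) - f x - D (t *\<^sub>R v))"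
      by (metis add.commute norm_minus_commute norm_triangle_sub)
    also have "\<dots> \<le> L * norm (t *\<^sub>R v) + e * norm (t *\<^sub>R v)"
      using d[of "x + t *\<^sub>R v"] t lipschitz_onD[OF assms(1), of "x + t *\<^sub>R v" x]
      by (intro add_mono) (auto simp: dist_norm)
    finally have "t * norm (D v) \<le> t * (L * norm v + e * norm v)"
      using t has_derivative_linear[OF D, THEN linear_scale] by (simp add: algebra_simps)
    then show ?thesis using t by simp
  qed
  show ?thesis
  proof (rule field_le_epsilon)
    fix e :: real assume "0 < e"
    then show "norm (D v) \<le> L * norm v + e"
      using bound[of "e / norm v"] False by simp
  qed
qed

text \<open>The step perturbs the identity by a map with Lipschitz constant
  \<open>h * L < 1\<close>, which cannot cancel a nonzero difference of two points.\<close>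

lemma inj_euler_step:
  fixes F :: "'a::real_normed_vector \<Rightarrow> 'a"
  assumes "L-lipschitz_on UNIV F" "0 \<le> h" "h * L < 1"
  shows "inj (\<lambda>x. x + h *\<^sub>R F x)"
proof (rule injI)
  fix x y assume "x + h *\<^sub>R F x = y + h *\<^sub>R F y"
  then have "x - y = h *\<^sub>R (F y - F x)" by (simp add: algebra_simps)
  then have "norm (x - y) = h * norm (F y - F x)" using assms by simp
  also have "\<dots> \<le> h * (L * norm (x - y))"
    using lipschitz_onD[OF assms(1), of y x] assms
    by (intro mult_left_mono) (auto simp: dist_norm norm_minus_commute)
  finally have "(1 - h * L) * norm (x - y) \<le> 0" by (simp add: algebra_simps)
  then show "x = y" using assms by (simp add: mult_le_0_iff)
qed

text \<open>Change of variables for the injective step, whose Jacobian determinant is at least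
  \<open>1 + h * g x - C * h\<^sup>2\<close> at each point. A continuous minorant \<open>g\<close>
  replaces the divergence, as \<open>F'\<close> may be discontinuous.\<close>

lemma euler_step_measure_ge:
  fixes F :: "real^'n::{finite,wellorder} \<Rightarrow> real^'n::_"
  assumes F': "\<And>x. (F has_derivative F' x) (at x)"
    and lip: "L-lipschitz_on UNIV F"
    and h: "0 \<le> h" "h \<le> 1" "h * L \<le> 1 / 2"
    and g: "continuous_on UNIV g" "\<And>x. g x \<le> trace (matrix (F' x))"
    and X: "X \<in> sets lebesgue" "bounded X"
  defines "C \<equiv> 2 * real CARD('n) * L\<^sup>2 + fact CARD('n) * (1 + L) ^ CARD('n)"
  shows "(\<lambda>x. x + h *\<^sub>R F x) ` X \<in> lmeasurable"
    and "measure lebesgue ((\<lambda>x. x + h *\<^sub>R F x) ` X) \<ge>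
      measure lebesgue X + h * integral X g - C * h\<^sup>2 * measure lebesgue X"
proof -
  let ?E = "\<lambda>x. x + h *\<^sub>R F x"
  let ?E' = "\<lambda>x v. v + h *\<^sub>R F' x v"
  have E': "(?E has_derivative ?E' x) (at x within X)" for x
    by (intro has_derivative_add has_derivative_ident has_derivative_scaleR_right
        has_derivative_at_withinI[OF F'])
  have inj: "inj_on ?E X"
    using inj_euler_step[OF lip h(1)] h inj_on_subset by fastforce
  have contF: "continuous_on UNIV F"
    using lip lipschitz_on_continuous_on by blast
  obtain a where "X \<subseteq> cbox (- a) a"
    using bounded_subset_cbox_symmetric X by blast
  then have "?E ` X \<subseteq> ?E ` cbox (- a) a" by blast
  moreover have "compact (?E ` cbox (- a) a)"
    by (intro compact_continuous_image continuous_intros continuous_on_subset[OF contF]) auto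
  ultimately have "bounded (?E ` X)" using bounded_subset compact_imp_bounded by blast
  moreover have "?E ` X \<in> sets lebesgue"
    using E' X by (intro differentiable_image_in_sets_lebesgue) (auto simp: differentiable_on_def differentiable_def)
  ultimately show lm: "?E ` X \<in> lmeasurable" by (rule bounded_set_imp_lmeasurable)
  have lmX: "X \<in> lmeasurable" using X by (simp add: bounded_set_imp_lmeasurable)
  have det: "1 + h * g x - C * h\<^sup>2 \<le> \<bar>det (matrix (?E' x))\<bar>" for x
  proof -
    have "matrix (?E' x) = mat 1 + h *\<^sub>R matrix (F' x)"
      by (simp add: matrix_def vec_eq_iff mat_def axis_def)
    moreover have "\<bar>matrix (F' x) $ i $ j\<bar> \<le> L" for i j
    proof -
      have "\<bar>matrix (F' x) $ i $ j\<bar> \<le> norm (F' x (axis j 1))"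
        by (simp add: matrix_def component_le_norm_cart)
      also have "\<dots> \<le> L"
        using lipschitz_on_has_derivative_norm_le[OF lip F', of x "axis j 1"] by (simp add: norm_axis_1)
      finally show ?thesis .
    qed
    ultimately have "det (matrix (?E' x)) \<ge> 1 + h * trace (matrix (F' x)) - C * h\<^sup>2"
      using det_mat_1_plus_scaleR_ge[of "matrix (F' x)" L h] h unfolding C_def by simp
    moreover have "h * g x \<le> h * trace (matrix (F' x))" using g h by (simp add: mult_left_mono)
    ultimately show ?thesis by linarith
  qed
  \<comment> \<open>Integrability of the Jacobian is read off from the finite measure of the image,
    which is already known.\<close>
  have int_det: "(\<lambda>x. \<bar>det (matrix (?E' x))\<bar>) integrable_on X"
    using measurable_differentiable_image_eq[OF X(1) E' inj] lm by blast
  have int_g: "g integrable_on X"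
  proof -
    have "g absolutely_integrable_on cbox (- a) a"
      by (intro absolutely_integrable_continuous continuous_on_subset[OF g(1)]) auto
    then have "g absolutely_integrable_on X"
      by (rule set_integrable_subset) (use X \<open>X \<subseteq> cbox (- a) a\<close> in auto)
    then show ?thesis using absolutely_integrable_on_def by blast
  qed
  have int1: "(\<lambda>x. 1 :: real) integrable_on X" and mX: "integral X (\<lambda>x. 1) = measure lebesgue X"
    using lmX by (auto simp: lmeasurable_iff_integrable_on lmeasure_integral)
  have "((\<lambda>x. 1 + h * g x - (C * h\<^sup>2) * 1) has_integral
      measure lebesgue X + h * integral X g - C * h\<^sup>2 * measure lebesgue X) X"
    using int_g int1 mX by (intro has_integral_add has_integral_diff has_integral_mult_right) (auto simp: has_integral_iff)
  then have "measure lebesgue X + h * integral X g - C * h\<^sup>2 * measure lebesgue X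
      \<le> integral X (\<lambda>x. \<bar>det (matrix (?E' x))\<bar>)"
    using int_det det by (intro has_integral_le[OF _ integrable_integral]) auto
  then show "measure lebesgue (?E ` X) \<ge>
      measure lebesgue X + h * integral X g - C * h\<^sup>2 * measure lebesgue X"
    using measure_differentiable_image_eq[OF X(1) E' inj int_det] by simp
qed

subsection \<open>Volume modulo periods\<close>

definition periods :: "(real^'n) set" where
  "periods = {v. \<forall>i. \<exists>k::int. v $ i = 2 * pi * of_int k}"

text \<open>Half-open, so that it contains exactly one point of each class modulo
  \<open>periods\<close>.\<close>

definition cell :: "(real^'n) set" where
  "cell = {x. \<forall>i. 0 \<le> x $ i \<and> x $ i < 2 * pi}"

lemma countable_periods: "countable (periods :: (real^'n) set)"
proof -
  have "(periods :: (real^'n) set) \<subseteq> range (\<lambda>k :: int^'n. \<chi> i. 2 * pi * of_int (k $ i))"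
  proof
    fix v :: "real^'n" assume "v \<in> periods"
    then obtain k :: "'n \<Rightarrow> int" where "\<And>i. v $ i = 2 * pi * of_int (k i)"
      unfolding periods_def by (auto dest!: choice)
    then show "v \<in> range (\<lambda>k :: int^'n. \<chi> i. 2 * pi * of_int (k $ i))"
      by (intro image_eqI[of _ _ "\<chi> i. k i"]) (auto simp: vec_eq_iff)
  qed
  then show ?thesis by (rule countable_subset) auto
qed

lemma periods_diff:
  assumes "u \<in> periods" "v \<in> periods"
  shows "u - v \<in> periods"
  unfolding periods_def
proof (intro CollectI allI)
  fix i
  obtain k l :: int where "u $ i = 2 * pi * of_int k" "v $ i = 2 * pi * of_int l"
    using assms unfolding periods_def by blast
  then show "\<exists>m :: int. (u - v) $ i = 2 * pi * of_int m"
    by (intro exI[of _ "k - l"]) (simp add: algebra_simps)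
qed

lemma periods_minus: "v \<in> periods \<Longrightarrow> - v \<in> periods"
proof -
  have "0 \<in> periods" unfolding periods_def by (auto intro!: exI[of _ 0])
  then show "v \<in> periods \<Longrightarrow> - v \<in> periods" using periods_diff[of 0 v] by simp
qed

lemma ex_periods_cell: obtains v where "v \<in> periods" "x - v \<in> cell"
proof
  let ?v = "\<chi> i. 2 * pi * of_int \<lfloor>x $ i / (2 * pi)\<rfloor>"
  show "?v \<in> periods" unfolding periods_def by auto
  have "0 \<le> x $ i - 2 * pi * of_int \<lfloor>x $ i / (2 * pi)\<rfloor>" "x $ i - 2 * pi * of_int \<lfloor>x $ i / (2 * pi)\<rfloor> < 2 * pi" for i
  proof -
    let ?k = "\<lfloor>x $ i / (2 * pi)\<rfloor>"
    have "of_int ?k \<le> x $ i / (2 * pi)" "x $ i / (2 * pi) < of_int ?k + 1" by linarith+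
    then have "2 * pi * of_int ?k \<le> 2 * pi * (x $ i / (2 * pi))"
      "2 * pi * (x $ i / (2 * pi)) < 2 * pi * (of_int ?k + 1)"
      by (intro mult_left_mono mult_strict_left_mono; simp)+
    then show "0 \<le> x $ i - 2 * pi * of_int ?k" "x $ i - 2 * pi * of_int ?k < 2 * pi"
      by (simp_all add: algebra_simps)
  qed
  then show "x - ?v \<in> cell" unfolding cell_def by simp
qed

lemma cell_eqI:
  assumes "x \<in> cell" "y \<in> cell" "x - y \<in> periods"
  shows "x = y"
proof -
  have "x $ i = y $ i" for i
  proof -
    obtain k :: int where k: "x $ i - y $ i = 2 * pi * of_int k"
      using assms(3) unfolding periods_def by auto
    moreover have "\<bar>x $ i - y $ i\<bar> < 2 * pi"
      using assms(1,2) unfolding cell_def by (smt (verit) mem_Collect_eq)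
    ultimately have "2 * pi * \<bar>of_int k\<bar> < 2 * pi * 1" by (simp add: abs_mult)
    then have "\<bar>of_int k :: real\<bar> < 1" by simp
    then have "k = 0" by linarith
    then show ?thesis using k by simp
  qed
  then show ?thesis by (simp add: vec_eq_iff)
qed

lemma cell_borel: "cell \<in> sets borel"
proof -
  have "cell = (\<Inter>i. {x :: real^'n. 0 \<le> x $ i} \<inter> {x. x $ i < 2 * pi})"
    unfolding cell_def by auto
  also have "\<dots> \<in> sets borel"
    by (intro sets.countable_INT' sets.Int borel_closed borel_open closed_Collect_le open_Collect_less continuous_intros) auto
  finally show ?thesis .
qed

lemma bounded_cell: "bounded cell"
proof (rule bounded_subset)
  show "bounded (cbox 0 (\<chi> i. 2 * pi))" by simp
  show "cell \<subseteq> cbox 0 (\<chi> i. 2 * pi)"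
    unfolding cell_def by (auto simp: mem_box_cart less_imp_le)
qed

text \<open>Cut \<open>A\<close> along the countably many translates of the cell and move each piece
  back into the cell. The pieces stay disjoint because no two points of \<open>A\<close> are
  congruent, and they stay in \<open>U\<close> because \<open>U\<close> is periodic.\<close>

lemma emeasure_le_emeasure_Int_cell:
  assumes A: "A \<in> sets lebesgue" and U: "U \<in> sets lebesgue" and "A \<subseteq> U"
    and perU: "\<And>x v. x \<in> U \<Longrightarrow> v \<in> periods \<Longrightarrow> x + v \<in> U"
    and inj: "\<And>x y. x \<in> A \<Longrightarrow> y \<in> A \<Longrightarrow> x - y \<in> periods \<Longrightarrow> x = y"
  shows "emeasure lebesgue A \<le> emeasure lebesgue (U \<inter> cell)"
proof -
  define P where "P v = A \<inter> (+) v ` cell" for v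
  define Q where "Q v = (+) (- v) ` P v" for v
  have cell: "cell \<in> sets lebesgue" using cell_borel by auto
  have P: "P v \<in> sets lebesgue" for v
    unfolding P_def using A cell by (intro sets.Int lebesgue_sets_translation)
  have Q: "Q v \<in> sets lebesgue" for v
    unfolding Q_def using P by (intro lebesgue_sets_translation)
  have dP: "disjoint_family_on P periods"
    unfolding disjoint_family_on_def
  proof (intro ballI impI equals0I)
    fix u v x assume "u \<in> periods" "v \<in> periods" "u \<noteq> v" and "x \<in> P u \<inter> P v"
    then obtain a b where "a \<in> cell" "b \<in> cell" "x = u + a" "x = v + b"
      unfolding P_def by blast
    then have "x - u \<in> cell" "x - v \<in> cell" by (simp, metis add_diff_cancel_left')
    moreover have "(x - u) - (x - v) \<in> periods"
      using periods_diff[OF \<open>v \<in> periods\<close> \<open>u \<in> periods\<close>] by simp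
    ultimately show False using cell_eqI \<open>u \<noteq> v\<close> by fastforce
  qed
  have dQ: "disjoint_family_on Q periods"
    unfolding disjoint_family_on_def
  proof (intro ballI impI equals0I)
    fix u v x assume uv: "u \<in> periods" "v \<in> periods" "u \<noteq> v" and "x \<in> Q u \<inter> Q v"
    then have "x + u \<in> A" "x + v \<in> A" unfolding P_def Q_def by (auto simp: add.commute)
    then have "x + u = x + v" using inj[of "x + u" "x + v"] periods_diff[OF uv(1,2)] by simp
    then show False using uv by simp
  qed
  have "A = (\<Union>v\<in>periods. P v)"
  proof -
    have "x \<in> (\<Union>v\<in>periods. P v)" if "x \<in> A" for x
    proof -
      obtain v where "v \<in> periods" "x - v \<in> cell" by (rule ex_periods_cell)
      then show ?thesis using that unfolding P_def
        by (auto intro!: bexI[of _ v] image_eqI[of _ _ "x - v"])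
    qed
    then show ?thesis unfolding P_def by auto
  qed
  then have "emeasure lebesgue A = (\<integral>\<^sup>+v. emeasure lebesgue (P v) \<partial>count_space periods)"
    using emeasure_UN_countable[OF P countable_periods dP] by simp
  also have "\<dots> = (\<integral>\<^sup>+v. emeasure lebesgue (Q v) \<partial>count_space periods)"
    using emeasure_lebesgue_affine[of 1 "- v" "P v" for v]
    by (intro nn_integral_cong) (simp add: Q_def add.commute)
  also have "\<dots> = emeasure lebesgue (\<Union>v\<in>periods. Q v)"
    using emeasure_UN_countable[OF Q countable_periods dQ] by simp
  also have "\<dots> \<le> emeasure lebesgue (U \<inter> cell)"
  proof (rule emeasure_mono)
    show "(\<Union>v\<in>periods. Q v) \<subseteq> U \<inter> cell"
      using \<open>A \<subseteq> U\<close> perU periods_minus unfolding Q_def P_def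
      by (fastforce simp: subset_iff)
    show "U \<inter> cell \<in> sets lebesgue" using U cell by auto
  qed
  finally show ?thesis .
qed

text \<open>Compare the step from \<open>x\<close> with the step from an arbitrary \<open>b\<close>
  in \<open>B\<close>: their distance is stretched by at most \<open>1 + h * L\<close>, and the step
  from \<open>b\<close> ends within \<open>c\<close> of \<open>B\<close>. Then take the infimum over
  \<open>b\<close>.\<close>

lemma infdist_euler_step_le:
  fixes F :: "'a::real_normed_vector \<Rightarrow> 'a"
  assumes lip: "L-lipschitz_on UNIV F" and "B \<noteq> {}" and h: "0 \<le> h"
    and viable: "\<And>b. b \<in> B \<Longrightarrow> infdist (b + h *\<^sub>R F b) B \<le> c"
  shows "infdist (x + h *\<^sub>R F x) B \<le> (1 + h * L) * infdist x B + c"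
proof -
  have L: "0 \<le> L" using lip lipschitz_on_nonneg by blast
  have *: "infdist (x + h *\<^sub>R F x) B - c \<le> (1 + h * L) * dist x b" if "b \<in> B" for b
  proof -
    have "dist (x + h *\<^sub>R F x) (b + h *\<^sub>R F b) \<le> dist x b + h * dist (F x) (F b)"
    proof -
      have "(x + h *\<^sub>R F x) - (b + h *\<^sub>R F b) = (x - b) + h *\<^sub>R (F x - F b)" by (simp add: algebra_simps)
      then show ?thesis
        using norm_triangle_ineq[of "x - b" "h *\<^sub>R (F x - F b)"] h
        by (simp only: dist_norm norm_scaleR abs_of_nonneg)
    qed
    also have "\<dots> \<le> dist x b + h * (L * dist x b)"
      using lipschitz_onD[OF lip, of x b] h by (intro add_mono mult_left_mono) auto
    finally show ?thesis
      using infdist_triangle[of "x + h *\<^sub>R F x" B "b + h *\<^sub>R F b"] viable[OF that] by (simp add: algebra_simps)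
  qed
  have pos: "1 + h * L > 0" using h L by (simp add: add_pos_nonneg)
  have "(infdist (x + h *\<^sub>R F x) B - c) / (1 + h * L) \<le> infdist x B"
    unfolding infdist_notempty[OF \<open>B \<noteq> {}\<close>, of x]
    using * pos \<open>B \<noteq> {}\<close> by (intro cINF_greatest) (auto simp: divide_simps mult.commute)
  then show ?thesis using pos by (simp add: divide_simps algebra_simps)
qed

text \<open>
  Euler steps carry a neighbourhood of \<open>B\<close> into a slightly larger one, while the divergence of \<open>F\<close>
  makes volumes grow at rate \<open>g\<close>. Modulo periods, the volumes of small neighbourhoods of \<open>B\<close> are all
  close to that of its closure, which leaves no room for growth.
\<close>
lemma negligible_closure_expanding:
  fixes F :: "real^'n::{finite,wellorder} \<Rightarrow> real^'n::_"
  assumes F': "\<And>x. (F has_derivative F' x) (at x)"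
    and lip: "L-lipschitz_on UNIV F"
    and perF: "\<And>x v. v \<in> periods \<Longrightarrow> F (x + v) = F x"
    and g: "continuous_on UNIV g" "\<And>x. g x \<le> trace (matrix (F' x))"
    and perg: "\<And>x v. v \<in> periods \<Longrightarrow> g (x + v) = g x"
    and perB: "\<And>x v. x \<in> B \<Longrightarrow> v \<in> periods \<Longrightarrow> x + v \<in> B"
    and D: "0 \<le> D"
    and viable: "\<And>b h. b \<in> B \<Longrightarrow> 0 \<le> h \<Longrightarrow> infdist (b + h *\<^sub>R F b) B \<le> D * h\<^sup>2"
    and nonneg: "0 < \<eta>0" "\<And>x. infdist x B \<le> \<eta>0 \<Longrightarrow> 0 \<le> g x"
  shows "negligible {x \<in> closure B. 0 < g x}"
proof (cases "B = {}")
  case False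
  \<comment> \<open>\<open>N \<delta>\<close> is the closed \<delta>-neighbourhood of
    \<open>B\<close>, and \<open>V \<delta>\<close> below is its volume modulo periods.\<close>
  define N where "N \<delta> = {x. infdist x B \<le> \<delta>}" for \<delta>
  define V where "V \<delta> = measure lebesgue (N \<delta> \<inter> cell)" for \<delta>
  define C where "C = 2 * real CARD('n) * L\<^sup>2 + fact CARD('n) * (1 + L) ^ CARD('n)"
  define v where "v = measure lebesgue (cell :: (real^'n::_) set)"
  \<comment> \<open>With step size and radius both at most \<open>\<eta>\<close>, one Euler step
    enlarges the radius by at most \<open>h * P * \<eta>\<close>. The summand 1 makes
    \<open>P\<close> positive.\<close>
  define P where "P = L + D + 1"
  have L: "0 \<le> L" using lip lipschitz_on_nonneg by blast
  have P: "P > 0" "L + D \<le> P" using L D by (auto simp: P_def)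
  have C: "0 \<le> C" using L by (simp add: C_def)
  have N_closed: "closed (N \<delta>)" for \<delta>
    unfolding N_def by (intro closed_Collect_le continuous_intros)
  have closed_leb: "X \<in> sets lebesgue" if "closed X" for X :: "(real^'n::_) set"
    using that by (simp add: borel_closed)
  have N_leb: "N \<delta> \<in> sets lebesgue" for \<delta>
    using N_closed by (rule closed_leb)
  have cell: "(cell :: (real^'n::_) set) \<in> sets lebesgue" using cell_borel by auto
  have N_cell: "N \<delta> \<inter> cell \<in> sets lebesgue" "bounded (N \<delta> \<inter> cell)" for \<delta>
    using N_leb cell bounded_cell by (auto simp: bounded_Int)
  have N_cell_lm: "N \<delta> \<inter> cell \<in> lmeasurable" for \<delta>
    using N_cell by (rule bounded_set_imp_lmeasurable[rotated])
  have cell_lm: "(cell :: (real^'n::_) set) \<in> lmeasurable"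
    using bounded_cell cell by (rule bounded_set_imp_lmeasurable)
  have V_le: "V \<delta> \<le> v" for \<delta>
    unfolding V_def v_def using N_cell cell_lm by (intro measure_mono_fmeasurable) auto
  have perN: "x + u \<in> N \<delta>" if "x \<in> N \<delta>" "u \<in> periods" for x u \<delta>
  proof -
    have "infdist (x + u) B \<le> infdist x B"
      unfolding infdist_notempty[OF False, of x]
    proof (rule cINF_greatest[OF False])
      fix b assume "b \<in> B"
      then show "infdist (x + u) B \<le> dist x b"
        using infdist_le[OF perB[OF _ that(2)], of b "x + u"] by (simp add: dist_norm)
    qed
    then show ?thesis using that by (simp add: N_def)
  qed
  have negl: "negligible {x \<in> N 0 \<inter> cell. c \<le> g x}" (is "negligible ?Y") if c: "c > 0" for c
  proof -
    define G where "G = c * measure lebesgue ?Y"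
    have Y_eq: "?Y = (N 0 \<inter> {x. c \<le> g x}) \<inter> cell" by auto
    have "closed {x. c \<le> g x}" using g(1) by (intro closed_Collect_le continuous_intros) auto
    then have "?Y \<in> sets lebesgue" unfolding Y_eq using N_leb cell closed_leb
      by (intro sets.Int)
    moreover have "bounded ?Y" using bounded_cell by (rule bounded_subset) auto
    ultimately have Y: "?Y \<in> lmeasurable" by (rule bounded_set_imp_lmeasurable[rotated])
    \<comment> \<open>Since \<open>g\<close> is nonnegative up to distance \<open>\<eta>0\<close>
      from \<open>B\<close>, passing from \<open>?Y\<close> to a larger neighbourhood can only
      increase the integral.\<close>
    have int_ge: "G \<le> integral (N \<delta> \<inter> cell) g" if "0 \<le> \<delta>" "\<delta> \<le> \<eta>0" for \<delta>
    proof -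
      obtain a :: "real^'n::_" where a: "cell \<subseteq> cbox (- a) a"
        using bounded_subset_cbox_symmetric bounded_cell by blast
      have gi: "g integrable_on X" if "X \<in> sets lebesgue" "X \<subseteq> cell" for X
      proof -
        have "g absolutely_integrable_on cbox (- a) a"
          by (intro absolutely_integrable_continuous continuous_on_subset[OF g(1)]) auto
        then have "g absolutely_integrable_on X"
          by (rule set_integrable_subset) (use that a in auto)
        then show ?thesis using absolutely_integrable_on_def by blast
      qed
      have "G = integral ?Y (\<lambda>x. c)"
        using lmeasure_integral[OF Y] integral_mult_right[of ?Y c "\<lambda>x. 1"] by (simp add: G_def)
      also have "\<dots> \<le> integral ?Y g"
        using Y gi[of ?Y] by (intro integral_le integrable_on_const) auto
      also have "\<dots> \<le> integral (N \<delta> \<inter> cell) g"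
        using Y gi[of ?Y] gi[of "N \<delta> \<inter> cell"] N_cell[of \<delta>] that nonneg(2)
        by (intro integral_subset_le) (auto simp: N_def)
      finally show ?thesis .
    qed
    \<comment> \<open>Bookkeeping for one Euler step: the volume gains at least \<open>h * G\<close>
      up to a quadratic error, while the image stays in a slightly wider neighbourhood.\<close>
    have step: "V \<delta> + h * (G - C * v * h) \<le> V (\<delta> + h * P * \<eta>)"
      if \<eta>: "0 < \<eta>" "\<eta> \<le> \<eta>0" and \<delta>: "0 \<le> \<delta>" "\<delta> \<le> \<eta>"
        and h: "0 < h" "h \<le> \<eta>" "h \<le> 1" "h * L \<le> 1 / 2" for \<delta> \<eta> h
    proof -
      let ?E = "\<lambda>x. x + h *\<^sub>R F x" and ?X = "N \<delta> \<inter> cell" and ?U = "N (\<delta> + h * P * \<eta>)"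
      have h0: "0 \<le> h" using h by simp
      note meas = euler_step_measure_ge[OF F' lip h0 h(3,4) g N_cell[of \<delta>]]
      have sub: "?E ` ?X \<subseteq> ?U"
      proof clarify
        fix x assume x: "x \<in> N \<delta>"
        have "infdist (?E x) B \<le> (1 + h * L) * infdist x B + D * h\<^sup>2"
          using infdist_euler_step_le[OF lip False h0 viable[OF _ h0]] .
        also have "\<dots> \<le> (1 + h * L) * \<delta> + D * h\<^sup>2"
          using x h0 L by (intro add_right_mono mult_left_mono) (auto simp: N_def)
        also have "\<dots> = \<delta> + h * (L * \<delta> + D * h)"
          by (simp add: algebra_simps power2_eq_square)
        also have "\<dots> \<le> \<delta> + h * (P * \<eta>)"
        proof -
          have "L * \<delta> + D * h \<le> L * \<eta> + D * \<eta>"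
            using L D \<delta> h by (intro add_mono mult_left_mono) auto
          also have "\<dots> \<le> P * \<eta>"
            using mult_right_mono[OF P(2), of \<eta>] \<eta> by (simp add: algebra_simps)
          finally show ?thesis using h0 by (simp add: mult_left_mono)
        qed
        finally show "?E x \<in> ?U" by (simp add: N_def mult.assoc)
      qed
      \<comment> \<open>By periodicity of \<open>F\<close>, translating the starting point by a
        period translates the endpoint. Congruent endpoints therefore come from congruent starting
        points, which coincide within the cell.\<close>
      have inj: "x = y" if xy: "x \<in> ?E ` ?X" "y \<in> ?E ` ?X" "x - y \<in> periods" for x y
      proof -
        obtain a b where a: "a \<in> cell" "x = ?E a" and b: "b \<in> cell" "y = ?E b" using xy by blast
        have "?E (b + (x - y)) = ?E a" using perF[OF xy(3), of b] a b by simp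
        then have "b + (x - y) = a"
          using inj_euler_step[OF lip h0] h(4) by (auto dest: injD)
        then have "a - b \<in> periods" using xy(3) by auto
        then show ?thesis using cell_eqI a b by blast
      qed
      have "emeasure lebesgue (?E ` ?X) \<le> emeasure lebesgue (?U \<inter> cell)"
        using meas(1) sub inj perN N_leb
        by (intro emeasure_le_emeasure_Int_cell) (auto simp: fmeasurable_def)
      then have "measure lebesgue (?E ` ?X) \<le> V (\<delta> + h * P * \<eta>)"
        unfolding V_def measure_def
        using N_cell_lm[of "\<delta> + h * P * \<eta>"] by (intro enn2real_mono) (auto simp: fmeasurable_def)
      moreover have "h * G \<le> h * integral ?X g"
        using int_ge \<delta> \<eta> h0 by (intro mult_left_mono) auto
      moreover have "C * h\<^sup>2 * V \<delta> \<le> C * h\<^sup>2 * v"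
        using V_le C by (intro mult_left_mono) auto
      ultimately show ?thesis using meas(2)
        unfolding C_def[symmetric] V_def[symmetric] by (simp add: algebra_simps power2_eq_square)
    qed
    \<comment> \<open>Here \<open>n\<close> steps of size \<open>1 / (n * P)\<close> widen the
      radius from 0 to \<open>\<eta>\<close>. Their total time is \<open>1 / P\<close> whatever
      \<open>\<eta>\<close> is, so the gain \<open>G / P\<close> persists for arbitrarily small
      \<open>\<eta>\<close>; the quadratic errors vanish as \<open>n\<close> grows.\<close>
    have growth: "V 0 + G / P \<le> V \<eta>" if \<eta>: "0 < \<eta>" "\<eta> \<le> \<eta>0" for \<eta>
    proof -
      have *: "V 0 + (G - C * v * (1 / (real n * P))) / P \<le> V \<eta>"
        if n: "n > 0" "1 / (real n * P) \<le> min \<eta> (min 1 (1 / (2 * P)))" for n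
      proof -
        define h where "h = 1 / (real n * P)"
        have h: "0 < h" "h \<le> \<eta>" "h \<le> 1" "h \<le> 1 / (2 * P)" using n P by (auto simp: h_def)
        have "h * L \<le> 1 / (2 * P) * P" using h P L D by (intro mult_mono) (auto simp: P_def)
        then have hL: "h * L \<le> 1 / 2" using P by simp
        have hP: "h * P * \<eta> = \<eta> / n" using P by (simp add: h_def)
        have "V 0 + real k * (h * (G - C * v * h)) \<le> V (real k * (\<eta> / n))" if "k \<le> n" for k
          using that
        proof (induction k)
          case (Suc k)
          have "real k * (\<eta> / n) \<le> real n * (\<eta> / n)" using Suc \<eta> by (intro mult_right_mono) auto
          then have "V (real k * (\<eta> / n)) + h * (G - C * v * h) \<le> V (real k * (\<eta> / n) + \<eta> / n)"
            using step[OF \<eta>, of "real k * (\<eta> / n)" h] h hL hP n \<eta> by simp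
          then show ?case using Suc by (simp add: algebra_simps add_divide_distrib)
        qed simp
        from this[of n] have "V 0 + (real n * h) * (G - C * v * h) \<le> V \<eta>" using n by (simp add: mult.assoc)
        moreover have "real n * h = 1 / P" using n by (simp add: h_def)
        ultimately show ?thesis by (simp add: h_def)
      qed
      have lim: "(\<lambda>n. 1 / (real n * P)) \<longlonglongrightarrow> 0"
        using tendsto_mult_right_zero[OF lim_inverse_n, of "1 / P"] by (simp add: field_simps)
      have "\<forall>\<^sub>F n in sequentially. 1 / (real n * P) < min \<eta> (min 1 (1 / (2 * P)))"
        using \<eta> P by (intro order_tendstoD(2)[OF lim]) simp
      then have "\<forall>\<^sub>F n in sequentially. V 0 + (G - C * v * (1 / (real n * P))) / P \<le> V \<eta>"
        using eventually_gt_at_top[of 0] by eventually_elim (intro *, auto)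
      moreover have "(\<lambda>n. V 0 + (G - C * v * (1 / (real n * P))) / P) \<longlonglongrightarrow> V 0 + (G - C * v * 0) / P"
        using P by (intro tendsto_intros lim) auto
      ultimately show ?thesis by (auto intro: tendsto_upperbound)
    qed
    \<comment> \<open>Continuity of the measure from above brings the volumes of shrinking
      neighbourhoods down to \<open>V 0\<close>, so the uniform gain must satisfy
      \<open>G \<le> 0\<close>.\<close>
    have "(\<lambda>n. V (\<eta>0 / Suc n)) \<longlonglongrightarrow> measure lebesgue (\<Inter>n. N (\<eta>0 / Suc n) \<inter> cell)"
      unfolding V_def
    proof (rule Lim_measure_decseq)
      show "decseq (\<lambda>n. N (\<eta>0 / Suc n) \<inter> cell)"
      proof (rule decseq_SucI)
        fix n
        have "\<eta>0 / Suc (Suc n) \<le> \<eta>0 / Suc n" using nonneg by (intro divide_left_mono) auto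
        then show "N (\<eta>0 / Suc (Suc n)) \<inter> cell \<subseteq> N (\<eta>0 / Suc n) \<inter> cell" by (auto simp: N_def)
      qed
      show "emeasure lebesgue (N (\<eta>0 / Suc n) \<inter> cell) \<noteq> \<infinity>" for n
        using N_cell_lm[of "\<eta>0 / Suc n"] by (auto simp: fmeasurable_def)
    qed (use N_cell in auto)
    also have "(\<Inter>n. N (\<eta>0 / Suc n) \<inter> cell) = N 0 \<inter> cell"
    proof -
      have "x \<in> N 0" if "\<And>n. x \<in> N (\<eta>0 / Suc n)" for x
      proof -
        have "(\<lambda>n. \<eta>0 / Suc n) \<longlonglongrightarrow> 0"
          using tendsto_mult_right_zero[OF LIMSEQ_inverse_real_of_nat, of \<eta>0] by (simp add: divide_inverse)
        then have "infdist x B \<le> 0"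
          by (rule tendsto_lowerbound) (use that in \<open>auto simp: N_def\<close>)
        then show ?thesis by (simp add: N_def)
      qed
      moreover have "x \<in> N (\<eta>0 / Suc n)" if "x \<in> N 0" for x n
        using that nonneg unfolding N_def by (smt (verit) divide_nonneg_nonneg mem_Collect_eq of_nat_0_le_iff)
      ultimately show ?thesis by blast
    qed
    finally have "(\<lambda>n. V (\<eta>0 / Suc n)) \<longlonglongrightarrow> V 0" by (simp add: V_def)
    moreover have "V 0 + G / P \<le> V (\<eta>0 / Suc n)" for n
      using nonneg by (intro growth) (auto simp: divide_simps)
    ultimately have "V 0 + G / P \<le> V 0"
      by (intro tendsto_lowerbound[where F=sequentially]) auto
    then have "G \<le> 0" using P by (simp add: divide_le_0_iff)
    then have "measure lebesgue ?Y = 0"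
      using c by (metis G_def linorder_not_less measure_nonneg mult_pos_pos order_le_less)
    then show ?thesis using Y negligible_iff_measure by blast
  qed
  \<comment> \<open>Countably many lattice translates and thresholds \<open>inverse (Suc n)\<close>
    reduce the claim to the sets treated in \<open>negl\<close>.\<close>
  have "{x \<in> closure B. 0 < g x} \<subseteq> (\<Union>u\<in>periods. \<Union>n. (+) u ` {x \<in> N 0 \<inter> cell. inverse (Suc n) \<le> g x})"
  proof
    fix x assume "x \<in> {x \<in> closure B. 0 < g x}"
    then have x: "x \<in> N 0" "0 < g x" using False by (auto simp: N_def in_closure_iff_infdist_zero)
    obtain u where u: "u \<in> periods" "x - u \<in> cell" by (rule ex_periods_cell)
    have "x + - u \<in> N 0" using perN[OF x(1)] periods_minus u by blast
    moreover have "g (x + - u) = g x" using perg periods_minus u by blast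
    moreover obtain n where "inverse (Suc n) < g x" using reals_Archimedean x by blast
    ultimately have "x - u \<in> {x \<in> N 0 \<inter> cell. inverse (Suc n) \<le> g x}" using u by auto
    then have "x \<in> (+) u ` {x \<in> N 0 \<inter> cell. inverse (Suc n) \<le> g x}"
      by (intro image_eqI[of _ _ "x - u"]) auto
    then show "x \<in> (\<Union>u\<in>periods. \<Union>n. (+) u ` {x \<in> N 0 \<inter> cell. inverse (Suc n) \<le> g x})"
      using u by blast
  qed
  moreover have "negligible (\<Union>u\<in>(periods :: (real^'n::_) set). \<Union>n. (+) u ` {x \<in> N 0 \<inter> cell. inverse (Suc n) \<le> g x})"
  proof -
    have "negligible {x \<in> N 0 \<inter> cell. inverse (Suc n) \<le> g x}" for n
      by (rule negl) simp
    then have "negligible ((+) u ` {x \<in> N 0 \<inter> cell. inverse (Suc n) \<le> g x})" for u n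
      by (rule negligible_translation)
    then have "negligible (\<Union>n. (+) u ` {x \<in> N 0 \<inter> cell. inverse (Suc n) \<le> g x})" for u
      by (intro negligible_countable_Union) blast+
    then show ?thesis
      using countable_periods by (intro negligible_countable_Union) blast+
  qed
  ultimately show ?thesis by (rule negligible_subset[rotated])
qed simp

subsection \<open>Trapping regions\<close>

text \<open>Look at the infimum of the times where \<open>P\<close> fails: \<open>lim\<close> gives
  \<open>P\<close> there, and \<open>step\<close> carries it a little further, contradicting the
  infimum. The base case is \<open>lim\<close> at \<open>t = a\<close>, where its premise is
  vacuous.\<close>

lemma real_interval_induct:
  fixes P :: "real \<Rightarrow> bool"
  assumes lim: "\<And>t. a \<le> t \<Longrightarrow> (\<And>s. a \<le> s \<Longrightarrow> s < t \<Longrightarrow> P s) \<Longrightarrow> P t"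
    and step: "\<And>t. a \<le> t \<Longrightarrow> P t \<Longrightarrow> \<exists>b>t. \<forall>s. t < s \<longrightarrow> s < b \<longrightarrow> P s"
    and "a \<le> t"
  shows "P t"
proof (rule ccontr)
  assume "\<not> P t"
  define X where "X = {s. a \<le> s \<and> \<not> P s}"
  have X: "t \<in> X" "bdd_below X" using \<open>\<not> P t\<close> \<open>a \<le> t\<close> by (auto simp: X_def intro!: bdd_belowI[of _ a])
  have a: "a \<le> Inf X" using X by (intro cInf_greatest) (auto simp: X_def)
  have below: "P s" if "a \<le> s" "s < Inf X" for s
    using that cInf_lower[OF _ X(2), of s] by (force simp: X_def)
  then have P: "P (Inf X)" using a lim by blast
  obtain b where b: "b > Inf X" "\<And>s. Inf X < s \<Longrightarrow> s < b \<Longrightarrow> P s"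
    using step[OF a P] by blast
  obtain s where "s \<in> X" "s < b" using cInf_lessD[of X b] b X by auto
  then have "Inf X \<le> s" "\<not> P s" using cInf_lower[OF _ X(2)] by (auto simp: X_def)
  then show False using b(2)[of s] \<open>s < b\<close> P by (cases "s = Inf X") auto
qed

text \<open>By induction along the half-line: the closed box survives limits from the left, and just
  after a time in the box, inner coordinates stay by continuity while those on a face are pushed
  inwards. Each sign condition may assume that all coordinates in \<open>A\<close> lie in the box at
  that time, which accommodates coupling.\<close>

lemma invariant_box:
  fixes x :: "real \<Rightarrow> 'i \<Rightarrow> real"
  assumes fin: "finite A"
    and der: "\<And>t j. a \<le> t \<Longrightarrow> j \<in> A \<Longrightarrow> ((\<lambda>t. x t j) has_real_derivative D t j) (at t within {a..})"
    and init: "\<And>j. j \<in> A \<Longrightarrow> x a j \<in> {lo j..hi j}"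
    and bdry: "\<And>t j. a \<le> t \<Longrightarrow> (\<And>i. i \<in> A \<Longrightarrow> x t i \<in> {lo i..hi i}) \<Longrightarrow> j \<in> A \<Longrightarrow>
      (x t j = hi j \<longrightarrow> D t j < 0) \<and> (x t j = lo j \<longrightarrow> 0 < D t j)"
    and "a \<le> t" "j \<in> A"
  shows "x t j \<in> {lo j..hi j}"
proof -
  have "\<forall>j\<in>A. x t j \<in> {lo j..hi j}"
  proof (rule real_interval_induct[where P = "\<lambda>t. \<forall>j\<in>A. x t j \<in> {lo j..hi j}", OF _ _ \<open>a \<le> t\<close>])
    fix t assume t: "a \<le> t" and below: "\<And>s. a \<le> s \<Longrightarrow> s < t \<Longrightarrow> \<forall>j\<in>A. x s j \<in> {lo j..hi j}"
    show "\<forall>j\<in>A. x t j \<in> {lo j..hi j}"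
    proof (cases "t = a")
      case False
      show ?thesis
      proof
        fix j assume j: "j \<in> A"
        have "((\<lambda>s. x s j) \<longlongrightarrow> x t j) (at t within {a..})"
          using DERIV_continuous[OF der[OF t j]] by (simp add: continuous_within)
        then have lim: "((\<lambda>s. x s j) \<longlongrightarrow> x t j) (at t within {a..<t})"
          by (rule tendsto_within_subset) auto
        have nt: "at t within {a..<t} \<noteq> bot"
          using False t by (simp add: at_within_eq_bot_iff)
        have "\<forall>\<^sub>F s in at t within {a..<t}. x s j \<in> {lo j..hi j}"
          using below j unfolding eventually_at_filter by (auto intro!: always_eventually)
        then show "x t j \<in> {lo j..hi j}"
          using Lim_in_closed_set[OF _ _ nt lim, of "{lo j..hi j}"] by blast
      qed
    qed (use init in auto)
  next
    fix t assume t: "a \<le> t" and box: "\<forall>j\<in>A. x t j \<in> {lo j..hi j}"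
    have "\<forall>\<^sub>F s in at_right t. x s j \<in> {lo j..hi j}" if j: "j \<in> A" for j
    proof -
      have der': "((\<lambda>t. x t j) has_real_derivative D t j) (at t within {t<..})"
        using t by (intro DERIV_subset[OF der[OF t j]]) auto
      have lim: "((\<lambda>s. x s j) \<longlongrightarrow> x t j) (at_right t)"
        using DERIV_continuous[OF der'] by (simp add: continuous_within)
      \<comment> \<open>On the face the strict sign of the derivative decides; off the face
        continuity suffices.\<close>
      have "\<forall>\<^sub>F s in at_right t. x s j \<le> hi j"
      proof (cases "x t j = hi j")
        case True
        then have "D t j < 0" using bdry[OF t _ j] box by blast
        from has_real_derivative_neg_dec_right[OF der' this]
        obtain d where d: "d > 0" "\<And>h. h > 0 \<Longrightarrow> h < d \<Longrightarrow> x (t + h) j < x t j" by auto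
        show ?thesis unfolding eventually_at_right_field
          using d(1) d(2)[of "s - t" for s] True by (intro exI[of _ "t + d"]) (auto intro: less_imp_le)
      next
        case False
        then have "x t j < hi j" using box j by force
        then show ?thesis
          using order_tendstoD(2)[OF lim, of "hi j"] by (auto elim!: eventually_mono)
      qed
      moreover have "\<forall>\<^sub>F s in at_right t. lo j \<le> x s j"
      proof (cases "x t j = lo j")
        case True
        then have "0 < D t j" using bdry[OF t _ j] box by blast
        from has_real_derivative_pos_inc_right[OF der' this]
        obtain d where d: "d > 0" "\<And>h. h > 0 \<Longrightarrow> h < d \<Longrightarrow> x t j < x (t + h) j" by auto
        show ?thesis unfolding eventually_at_right_field
          using d(1) d(2)[of "s - t" for s] True by (intro exI[of _ "t + d"]) (auto intro: less_imp_le)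
      next
        case False
        then have "lo j < x t j" using box j by force
        then show ?thesis
          using order_tendstoD(1)[OF lim, of "lo j"] by (auto elim!: eventually_mono)
      qed
      ultimately show ?thesis by eventually_elim auto
    qed
    then have "\<forall>\<^sub>F s in at_right t. \<forall>j\<in>A. x s j \<in> {lo j..hi j}"
      using fin by (intro eventually_ball_finite) auto
    then show "\<exists>b>t. \<forall>s. t < s \<longrightarrow> s < b \<longrightarrow> (\<forall>j\<in>A. x s j \<in> {lo j..hi j})"
      unfolding eventually_at_right_field by blast
  qed
  then show ?thesis using \<open>j \<in> A\<close> by blast
qed

subsection \<open>The Winfree field\<close>

lemma periodic_of_int:
  fixes f :: "real \<Rightarrow> 'a"
  assumes "\<forall>x. f (x + 2 * pi) = f x"
  shows "f (x + 2 * pi * of_int k) = f x"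
proof (induction k arbitrary: x rule: int_induct[where k = 0])
  case (step1 i)
  have "f (x + 2 * pi * of_int (i + 1)) = f ((x + 2 * pi * of_int i) + 2 * pi)" by (simp add: algebra_simps)
  then show ?case using assms step1 by simp
next
  case (step2 i)
  have "f (x + 2 * pi * of_int i) = f ((x + 2 * pi * of_int (i - 1)) + 2 * pi)" by (simp add: algebra_simps)
  then show ?case using assms step2 by metis
qed simp

lemma ex_int_shift_pi:
  fixes x :: real
  obtains k :: int where "- pi \<le> x - 2 * pi * of_int k" "x - 2 * pi * of_int k < pi"
proof -
  let ?k = "\<lfloor>(x + pi) / (2 * pi)\<rfloor>"
  have "of_int ?k \<le> (x + pi) / (2 * pi)" "(x + pi) / (2 * pi) < of_int ?k + 1" by linarith+
  then have "2 * pi * of_int ?k \<le> 2 * pi * ((x + pi) / (2 * pi))"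
    "2 * pi * ((x + pi) / (2 * pi)) < 2 * pi * (of_int ?k + 1)"
    by (intro mult_left_mono mult_strict_left_mono; simp)+
  moreover have "2 * pi * ((x + pi) / (2 * pi)) = x + pi" by simp
  ultimately show ?thesis by (intro that[of ?k]) (simp_all add: algebra_simps)
qed

lemma periodic_continuous_bounded:
  fixes f :: "real \<Rightarrow> real"
  assumes per: "\<forall>x. f (x + 2 * pi) = f x" and cont: "continuous_on UNIV f"
  obtains M where "\<And>x. \<bar>f x\<bar> \<le> M"
proof -
  have "compact (f ` {-pi..pi})"
    by (intro compact_continuous_image continuous_on_subset[OF cont]) auto
  then obtain M where M: "\<And>x. x \<in> {-pi..pi} \<Longrightarrow> \<bar>f x\<bar> \<le> M"
    using compact_imp_bounded[of "f ` {-pi..pi}"] unfolding bounded_iff real_norm_def by blast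
  have "\<bar>f x\<bar> \<le> M" for x
  proof -
    obtain k :: int where "- pi \<le> x - 2 * pi * of_int k" "x - 2 * pi * of_int k < pi"
      by (rule ex_int_shift_pi)
    then have "\<bar>f (x - 2 * pi * of_int k)\<bar> \<le> M" by (intro M) auto
    then show ?thesis using periodic_of_int[OF per, of "x - 2 * pi * of_int k" k] by simp
  qed
  then show ?thesis by (rule that)
qed

section \<open>Periodicity, regularity and divergence of the field\<close>

lemma kur_field_nth: "kur_field S I w \<kappa> x $ i = w $ i + \<kappa> * order_R I x * S (x $ i)"
  by (simp add: kur_field_def order_R_def)

lemma periodic_add_periods:
  assumes "\<forall>x. f (x + 2 * pi) = f x" and v: "v \<in> periods"
  shows "f ((x + v) $ i) = f (x $ i)"
proof -
  obtain k :: int where "v $ i = 2 * pi * of_int k" using v unfolding periods_def by blast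
  then show ?thesis using periodic_of_int[OF assms(1)] by simp
qed

lemma order_R_add_periods:
  assumes "\<forall>x. I (x + 2 * pi) = I x" "v \<in> periods"
  shows "order_R I (x + v) = order_R I x"
  unfolding order_R_def using periodic_add_periods[OF assms] by simp

lemma kur_field_add_periods:
  assumes "\<forall>x. S (x + 2 * pi) = S x" "\<forall>x. I (x + 2 * pi) = I x" "v \<in> periods"
  shows "kur_field S I w \<kappa> (x + v) = kur_field S I w \<kappa> x"
  using periodic_add_periods[OF assms(1,3)] order_R_add_periods[OF assms(2,3)]
  by (simp add: vec_eq_iff kur_field_nth)

lemma lipschitz_order_R:
  assumes lip: "L-lipschitz_on UNIV I"
  shows "L-lipschitz_on UNIV (order_R I :: real^'n \<Rightarrow> real)"
proof (rule lipschitz_onI)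
  fix x y :: "real^'n"
  have "\<bar>I (x $ j) - I (y $ j)\<bar> \<le> L * dist x y" for j
  proof -
    have "\<bar>I (x $ j) - I (y $ j)\<bar> \<le> L * \<bar>x $ j - y $ j\<bar>"
      using lipschitz_onD[OF lip, of "x $ j" "y $ j"] by (simp add: dist_real_def)
    also have "\<dots> \<le> L * dist x y"
      using component_le_norm_cart[of "x - y" j] lipschitz_on_nonneg[OF lip]
      by (intro mult_left_mono) (auto simp: dist_norm)
    finally show ?thesis .
  qed
  then have "(\<Sum>j\<in>UNIV. \<bar>I (x $ j) - I (y $ j)\<bar>) \<le> real CARD('n) * (L * dist x y)"
    using sum_bounded_above[of "UNIV :: 'n set" "\<lambda>j. \<bar>I (x $ j) - I (y $ j)\<bar>" "L * dist x y"] by simp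
  moreover have "\<bar>\<Sum>j\<in>UNIV. I (x $ j) - I (y $ j)\<bar> \<le> (\<Sum>j\<in>UNIV. \<bar>I (x $ j) - I (y $ j)\<bar>)"
    by (rule sum_abs)
  ultimately have "\<bar>(\<Sum>j\<in>UNIV. I (x $ j)) - (\<Sum>j\<in>UNIV. I (y $ j))\<bar> \<le> real CARD('n) * (L * dist x y)"
    by (simp add: sum_subtractf)
  then have "\<bar>(\<Sum>j\<in>UNIV. I (x $ j)) - (\<Sum>j\<in>UNIV. I (y $ j))\<bar> / real CARD('n) \<le> L * dist x y"
    by (simp add: divide_simps mult.commute)
  then show "dist (order_R I x) (order_R I y) \<le> L * dist x y"
    by (simp add: order_R_def dist_real_def diff_divide_distrib[symmetric])
qed (rule lipschitz_on_nonneg[OF lip])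

lemma order_R_nonneg: "(\<And>x. 0 \<le> I x) \<Longrightarrow> 0 \<le> order_R I x"
  unfolding order_R_def by (intro divide_nonneg_nonneg sum_nonneg) auto

lemma abs_order_R_le:
  fixes x :: "real^'n"
  assumes "\<And>x. \<bar>I x\<bar> \<le> M"
  shows "\<bar>order_R I x\<bar> \<le> M"
proof -
  have "\<bar>\<Sum>j\<in>UNIV. I (x $ j)\<bar> \<le> (\<Sum>j\<in>UNIV. \<bar>I (x $ j)\<bar>)" by (rule sum_abs)
  also have "\<dots> \<le> real CARD('n) * M" using sum_bounded_above[of "UNIV :: 'n set" "\<lambda>j. \<bar>I (x $ j)\<bar>" M] assms by simp
  finally show ?thesis by (simp add: order_R_def divide_simps mult.commute)
qed

text \<open>A product of Lipschitz functions is Lipschitz when both are bounded; for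
  \<open>S\<close> and \<open>I\<close> such bounds will come from periodicity.\<close>

lemma kur_field_lipschitz_bounded:
  fixes w :: "real^'n" and LS LI MS MI :: real
  assumes LS: "LS-lipschitz_on UNIV S" and LI: "LI-lipschitz_on UNIV I"
    and MS: "\<And>x. \<bar>S x\<bar> \<le> MS" and MI: "\<And>x. \<bar>I x\<bar> \<le> MI"
  obtains L M where "L-lipschitz_on UNIV (kur_field S I w \<kappa>)" "\<And>x. norm (kur_field S I w \<kappa> x) \<le> M"
proof -
  let ?F = "kur_field S I w \<kappa>"
  let ?l = "\<bar>\<kappa>\<bar> * (MI * LS + LI * MS)"
  have MI0: "0 \<le> MI" "0 \<le> MS" using MI[of 0] MS[of 0] by linarith+
  have L0: "0 \<le> LS" "0 \<le> LI" using LS LI lipschitz_on_nonneg by blast+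
  have "\<bar>(?F x - ?F y) $ i\<bar> \<le> ?l * dist x y" for x y i
  proof -
    have "(?F x - ?F y) $ i = \<kappa> * (order_R I x * (S (x $ i) - S (y $ i)) + (order_R I x - order_R I y) * S (y $ i))"
      by (simp add: kur_field_nth algebra_simps)
    moreover have "\<bar>order_R I x * (S (x $ i) - S (y $ i))\<bar> \<le> MI * (LS * dist x y)"
    proof -
      have "\<bar>S (x $ i) - S (y $ i)\<bar> \<le> LS * \<bar>x $ i - y $ i\<bar>"
        using lipschitz_onD[OF LS, of "x $ i" "y $ i"] by (simp add: dist_real_def)
      also have "\<dots> \<le> LS * dist x y"
        using component_le_norm_cart[of "x - y" i] L0 by (intro mult_left_mono) (auto simp: dist_norm)
      finally show ?thesis
        unfolding abs_mult using abs_order_R_le[of I MI x] MI MI0 by (intro mult_mono) auto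
    qed
    moreover have "\<bar>(order_R I x - order_R I y) * S (y $ i)\<bar> \<le> (LI * dist x y) * MS"
      unfolding abs_mult using lipschitz_onD[OF lipschitz_order_R[OF LI], of x y] MS L0
      by (intro mult_mono) (auto simp: dist_real_def)
    ultimately have "\<bar>(?F x - ?F y) $ i\<bar> \<le> \<bar>\<kappa>\<bar> * (MI * (LS * dist x y) + (LI * dist x y) * MS)"
      by (simp only: abs_mult[of \<kappa>]) (intro mult_left_mono abs_triangle_ineq[THEN order_trans] add_mono; simp)
    then show ?thesis by (simp add: algebra_simps)
  qed
  then have "norm (?F x - ?F y) \<le> real CARD('n) * (?l * dist x y)" for x y
    using norm_le_l1_cart[of "?F x - ?F y"] sum_bounded_above[of "UNIV :: 'n set" "\<lambda>i. \<bar>(?F x - ?F y) $ i\<bar>" "?l * dist x y"]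
    by fastforce
  then have "(real CARD('n) * ?l)-lipschitz_on UNIV ?F"
    using MI0 L0 by (intro lipschitz_onI) (auto simp: dist_norm mult.assoc)
  moreover have "norm (?F x) \<le> (\<Sum>i\<in>UNIV. \<bar>w $ i\<bar> + \<bar>\<kappa>\<bar> * MI * MS)" for x
  proof -
    have "\<bar>?F x $ i\<bar> \<le> \<bar>w $ i\<bar> + \<bar>\<kappa>\<bar> * MI * MS" for i
    proof -
      have "\<bar>\<kappa> * order_R I x * S (x $ i)\<bar> \<le> \<bar>\<kappa>\<bar> * MI * MS"
        unfolding abs_mult using abs_order_R_le[of I MI x] MI MS MI0 by (intro mult_mono) auto
      then show ?thesis by (simp add: kur_field_nth)
    qed
    then show ?thesis using norm_le_l1_cart[of "?F x"] by (meson order_trans sum_mono)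
  qed
  ultimately show ?thesis by (rule that)
qed

lemma kur_field_has_derivative:
  fixes w :: "real^'n"
  assumes S: "\<forall>x. S differentiable (at x)" and I: "\<forall>x. I differentiable (at x)"
  shows "(kur_field S I w \<kappa> has_derivative
    (\<lambda>v. \<chi> i. \<kappa> * ((\<Sum>j\<in>UNIV. deriv I (x $ j) * v $ j) / real CARD('n) * S (x $ i)
      + order_R I x * (deriv S (x $ i) * v $ i)))) (at x)"
proof -
  have nth: "((\<lambda>y. y $ j) has_derivative (\<lambda>v. v $ j)) (at x)" for j :: 'n
    by (rule bounded_linear.has_derivative[OF bounded_linear_vec_nth has_derivative_ident])
  have comp: "((\<lambda>y. f (y $ j)) has_derivative (\<lambda>v. deriv f (x $ j) * v $ j)) (at x)"
    if "\<forall>x. f differentiable (at x)" for f :: "real \<Rightarrow> real" and j :: 'n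
  proof -
    have "(f has_derivative (*) (deriv f (x $ j))) (at (x $ j))"
      using that DERIV_deriv_iff_real_differentiable has_field_derivative_def by blast
    from has_derivative_compose[OF nth this] show ?thesis .
  qed
  have R: "(order_R I has_derivative (\<lambda>v. (\<Sum>j\<in>UNIV. deriv I (x $ j) * v $ j) / real CARD('n))) (at x)"
    unfolding order_R_def[abs_def] divide_inverse
    by (intro has_derivative_mult_left has_derivative_sum comp I)
  have "((\<lambda>y. w $ i + \<kappa> * (order_R I y * S (y $ i))) has_derivative
      (\<lambda>v. 0 + \<kappa> * (order_R I x * (deriv S (x $ i) * v $ i)
        + (\<Sum>j\<in>UNIV. deriv I (x $ j) * v $ j) / real CARD('n) * S (x $ i)))) (at x)" for i
    by (intro has_derivative_add has_derivative_const has_derivative_mult_right has_derivative_mult R comp S)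
  then have "((\<lambda>y. \<chi> i. w $ i + \<kappa> * (order_R I y * S (y $ i))) has_derivative
      (\<lambda>v. \<chi> i. 0 + \<kappa> * (order_R I x * (deriv S (x $ i) * v $ i)
        + (\<Sum>j\<in>UNIV. deriv I (x $ j) * v $ j) / real CARD('n) * S (x $ i)))) (at x)"
    by (subst has_derivative_componentwise_within) (auto simp: Basis_vec_def inner_axis)
  then show ?thesis
    by (simp add: kur_field_def[abs_def] order_R_def[abs_def] add.commute mult.assoc)
qed

text \<open>The \<open>i\<close>-th diagonal entry consists of a multiple of
  \<open>deriv I * deriv\<close>-free type \<open>I' S\<close>, nonnegative by
  \<open>I_deriv\<close>, and of \<open>\<kappa> * R * S'\<close>, bounded below by
  \<open>S_deriv\<close>. In the sum over \<open>i\<close> the values of \<open>I\<close> add up to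
  the cardinality times \<open>R\<close>.\<close>

lemma trace_kur_field_derivative_ge:
  fixes x :: "real^'n"
  assumes I0: "\<And>x. 0 \<le> I x" and "0 \<le> \<kappa>"
    and S_deriv: "\<forall>x. deriv S x \<ge> c4 * (Istar - I x)"
    and I_deriv: "\<forall>x. deriv I x * S x \<ge> 0"
  shows "\<kappa> * c4 * real CARD('n) * order_R I x * (Istar - order_R I x) \<le>
    trace (matrix (\<lambda>v. \<chi> i. \<kappa> * ((\<Sum>j\<in>UNIV. deriv I (x $ j) * v $ j) / real CARD('n) * S (x $ i)
      + order_R I x * (deriv S (x $ i) * v $ i))))"
proof -
  let ?R = "order_R I x"
  have R: "0 \<le> ?R" using I0 by (rule order_R_nonneg)
  have "\<kappa> * (?R * (c4 * (Istar - I (x $ i)))) \<le>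
      \<kappa> * ((\<Sum>j\<in>UNIV. deriv I (x $ j) * axis i 1 $ j) / real CARD('n) * S (x $ i)
        + ?R * (deriv S (x $ i) * axis i 1 $ i))" for i
  proof -
    have "(\<Sum>j\<in>UNIV. deriv I (x $ j) * axis i 1 $ j) = deriv I (x $ i)"
      by (simp add: axis_def if_distrib cong: if_cong)
    moreover have "0 \<le> deriv I (x $ i) / real CARD('n) * S (x $ i)"
      using I_deriv by simp
    moreover have "?R * (c4 * (Istar - I (x $ i))) \<le> ?R * deriv S (x $ i)"
      using S_deriv R by (intro mult_left_mono) auto
    ultimately show ?thesis using \<open>0 \<le> \<kappa>\<close> by (intro mult_left_mono) (auto simp: axis_def)
  qed
  then have "(\<Sum>i\<in>UNIV. \<kappa> * (?R * (c4 * (Istar - I (x $ i))))) \<le>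
    trace (matrix (\<lambda>v. \<chi> i. \<kappa> * ((\<Sum>j\<in>UNIV. deriv I (x $ j) * v $ j) / real CARD('n) * S (x $ i)
      + ?R * (deriv S (x $ i) * v $ i))))"
    unfolding trace_def matrix_def by (simp add: sum_mono)
  moreover have "(\<Sum>i\<in>UNIV. \<kappa> * (?R * (c4 * (Istar - I (x $ i)))))
      = \<kappa> * ?R * c4 * (real CARD('n) * Istar - (\<Sum>i\<in>UNIV. I (x $ i)))"
    by (simp add: sum_distrib_left[symmetric] sum_subtractf algebra_simps)
  moreover have "(\<Sum>i\<in>UNIV. I (x $ i)) = real CARD('n) * ?R"
    by (simp add: order_R_def)
  ultimately show ?thesis by (simp add: algebra_simps)
qed

section \<open>Solutions and the null set of initial data with low order parameter\<close>

definition kur_solution ::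
  "(real \<Rightarrow> real) \<Rightarrow> (real \<Rightarrow> real) \<Rightarrow> real^'n \<Rightarrow> real \<Rightarrow> (real \<Rightarrow> real^'n) \<Rightarrow> bool" where
  "kur_solution S I w \<kappa> \<theta> \<longleftrightarrow>
     (\<forall>t\<ge>0. (\<theta> has_vector_derivative kur_field S I w \<kappa> (\<theta> t)) (at t within {0..}))"

lemma kur_solution_shift:
  assumes "kur_solution S I w \<kappa> \<theta>" "0 \<le> a"
  shows "kur_solution S I w \<kappa> (\<lambda>t. \<theta> (t + a))"
  unfolding kur_solution_def
proof (intro allI impI)
  fix t :: real assume t: "0 \<le> t"
  have "(\<theta> has_vector_derivative kur_field S I w \<kappa> (\<theta> (t + a))) (at (t + a) within (\<lambda>s. s + a) ` {0..})"
  proof (rule has_vector_derivative_within_subset)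
    show "(\<theta> has_vector_derivative kur_field S I w \<kappa> (\<theta> (t + a))) (at (t + a) within {0..})"
      using assms t unfolding kur_solution_def by simp
  qed (use assms in auto)
  moreover have "((\<lambda>s. s + a) has_vector_derivative 1) (at t within {0..})"
    by (auto intro!: derivative_eq_intros)
  ultimately show "((\<lambda>t. \<theta> (t + a)) has_vector_derivative kur_field S I w \<kappa> (\<theta> (t + a))) (at t within {0..})"
    using vector_diff_chain_within[of "\<lambda>s. s + a" 1 t "{0..}" \<theta>] by (simp add: o_def)
qed

lemma kur_solution_add_periods:
  assumes "kur_solution S I w \<kappa> \<theta>" "v \<in> periods"
    and "\<forall>x. S (x + 2 * pi) = S x" "\<forall>x. I (x + 2 * pi) = I x"
  shows "kur_solution S I w \<kappa> (\<lambda>t. \<theta> t + v)"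
  using assms kur_field_add_periods[OF assms(3,4,2)]
  unfolding kur_solution_def by (simp add: has_vector_derivative_add_const)

text \<open>Mean value inequality twice: the curve moves by at most \<open>M * h\<close>, so its
  velocity deviates from the initial one by at most \<open>L * M * h\<close>; integrated over time
  \<open>h\<close> this gives the quadratic error.\<close>

lemma kur_solution_euler_error:
  assumes sol: "kur_solution S I w \<kappa> \<theta>" and lip: "L-lipschitz_on UNIV (kur_field S I w \<kappa>)"
    and bnd: "\<And>x. norm (kur_field S I w \<kappa> x) \<le> M" and h: "0 \<le> h"
  shows "dist (\<theta> 0 + h *\<^sub>R kur_field S I w \<kappa> (\<theta> 0)) (\<theta> h) \<le> L * M * h\<^sup>2"
proof -
  let ?F = "kur_field S I w \<kappa>"
  have L: "0 \<le> L" using lip lipschitz_on_nonneg by blast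
  have M: "0 \<le> M" using norm_ge_zero bnd by (rule order_trans)
  have der: "(\<theta> has_derivative (\<lambda>s. s *\<^sub>R ?F (\<theta> t))) (at t within {0..h})" if "t \<in> {0..h}" for t
    using sol that unfolding kur_solution_def has_vector_derivative_def
    by (auto intro: has_derivative_subset)
  have near: "norm (\<theta> t - \<theta> 0) \<le> M * h" if t: "t \<in> {0..h}" for t
  proof -
    have "norm (\<theta> t - \<theta> 0) \<le> M * norm (t - 0)"
    proof (rule differentiable_bound[OF convex_real_interval(5) der])
      show "onorm (\<lambda>s. s *\<^sub>R ?F (\<theta> t)) \<le> M" for t
        by (intro onorm_le) (simp add: mult.commute[of M] mult_left_mono bnd)
    qed (use t h in auto)
    also have "\<dots> \<le> M * h" using t M by (intro mult_left_mono) auto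
    finally show ?thesis .
  qed
  have "norm ((\<theta> h - h *\<^sub>R ?F (\<theta> 0)) - (\<theta> 0 - 0 *\<^sub>R ?F (\<theta> 0))) \<le> (L * (M * h)) * norm (h - 0)"
  proof (rule differentiable_bound[OF convex_real_interval(5)])
    fix t assume t: "t \<in> {0..h}"
    show "((\<lambda>t. \<theta> t - t *\<^sub>R ?F (\<theta> 0)) has_derivative (\<lambda>s. s *\<^sub>R ?F (\<theta> t) - s *\<^sub>R ?F (\<theta> 0))) (at t within {0..h})"
      by (intro has_derivative_diff der[OF t] has_derivative_scaleR_left has_derivative_ident)
    have "norm (?F (\<theta> t) - ?F (\<theta> 0)) \<le> L * (M * h)"
      using lipschitz_onD[OF lip, of "\<theta> t" "\<theta> 0"] mult_left_mono[OF near[OF t] L] by (simp add: dist_norm)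
    then show "onorm (\<lambda>s. s *\<^sub>R ?F (\<theta> t) - s *\<^sub>R ?F (\<theta> 0)) \<le> L * (M * h)"
      by (intro onorm_le) (simp add: mult.commute[of "L * (M * h)"] mult_left_mono flip: scaleR_diff_right)
  qed (use h in auto)
  then show ?thesis
    using h by (simp add: dist_norm norm_minus_commute power2_eq_square algebra_simps)
qed

text \<open>Asking for some solution makes the set forward invariant by time shift, and from a point
  outside it every solution exceeds the level \<open>r\<close> at some time.\<close>

definition low_order_set ::
  "(real \<Rightarrow> real) \<Rightarrow> (real \<Rightarrow> real) \<Rightarrow> real^'n \<Rightarrow> real \<Rightarrow> real \<Rightarrow> (real^'n) set" where
  "low_order_set S I w \<kappa> r =
     {\<theta> 0 |\<theta>. kur_solution S I w \<kappa> \<theta> \<and> (\<forall>t\<ge>0. order_R I (\<theta> t) \<le> r)}"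

text \<open>Apply the expansion argument with \<open>g\<close> the lower bound of the divergence: it
  is positive wherever \<open>0 < R < Istar\<close>, hence on all of the set except where
  \<open>R = 0\<close>, and those points are countable.\<close>

lemma negligible_low_order_set_wellorder:
  fixes w :: "real^'n::{finite,wellorder}"
  assumes perS: "\<forall>x. S (x + 2 * pi) = S x" and perI: "\<forall>x. I (x + 2 * pi) = I x"
    and lipS: "LS-lipschitz_on UNIV S" and lipI: "LI-lipschitz_on UNIV I"
    and S_diff: "\<forall>x. S differentiable (at x)" and I_diff: "\<forall>x. I differentiable (at x)"
    and S_deriv: "\<forall>x. deriv S x \<ge> c4 * (Istar - I x)"
    and I_deriv: "\<forall>x. deriv I x * S x \<ge> 0"
    and I0: "\<And>x. 0 \<le> I x" and Ipos: "\<forall>x\<in>{-pi<..<pi}. I x > 0"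
    and pos: "0 < c4" "0 < \<kappa>" and r: "r < Istar"
  shows "negligible (low_order_set S I w \<kappa> r)" (is "negligible ?B")
proof (cases "?B = {}")
  case False
  let ?F = "kur_field S I w \<kappa>"
  define g where "g x = \<kappa> * c4 * real CARD('n) * order_R I x * (Istar - order_R I x)" for x :: "real^'n::_"
  obtain KS where KS: "\<And>x. \<bar>S x\<bar> \<le> KS"
    using periodic_continuous_bounded[OF perS lipschitz_on_continuous_on[OF lipS]] by blast
  obtain KI where KI: "\<And>x. \<bar>I x\<bar> \<le> KI"
    using periodic_continuous_bounded[OF perI lipschitz_on_continuous_on[OF lipI]] by blast
  obtain L M where L: "L-lipschitz_on UNIV ?F" and M: "\<And>x. norm (?F x) \<le> M"
    using kur_field_lipschitz_bounded[OF lipS lipI KS KI] by blast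
  note lipR = lipschitz_order_R[OF lipI]
  have contR: "continuous_on UNIV (order_R I)" using lipR lipschitz_on_continuous_on by blast
  have LI: "0 \<le> LI" and L0: "0 \<le> L" using lipI L lipschitz_on_nonneg by blast+
  have M0: "0 \<le> M" using M[of 0] norm_ge_zero order_trans by blast
  have R0: "0 \<le> order_R I x" for x :: "real^'n::_" using I0 by (rule order_R_nonneg)
  have R_B: "order_R I b \<le> r" if "b \<in> ?B" for b using that by (auto simp: low_order_set_def)
  have "negligible {x \<in> closure ?B. 0 < g x}"
  proof (rule negligible_closure_expanding[OF kur_field_has_derivative[OF S_diff I_diff] L])
    show "?F (x + v) = ?F x" if "v \<in> periods" for x v
      using kur_field_add_periods[OF perS perI that] .
    show "continuous_on UNIV g" unfolding g_def by (intro continuous_intros contR)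
    show "g x \<le> trace (matrix (\<lambda>v. \<chi> i. \<kappa> * ((\<Sum>j\<in>UNIV. deriv I (x $ j) * v $ j) / real CARD('n) * S (x $ i)
      + order_R I x * (deriv S (x $ i) * v $ i))))" for x
      unfolding g_def using pos by (intro trace_kur_field_derivative_ge I0 S_deriv I_deriv) auto
    show "g (x + v) = g x" if "v \<in> periods" for x v
      unfolding g_def using order_R_add_periods[OF perI that] by simp
    show "x + v \<in> ?B" if xv: "x \<in> ?B" "v \<in> periods" for x v
    proof -
      obtain \<theta> where \<theta>: "x = \<theta> 0" "kur_solution S I w \<kappa> \<theta>" "\<And>t. 0 \<le> t \<Longrightarrow> order_R I (\<theta> t) \<le> r"
        using xv(1) unfolding low_order_set_def by blast
      then show ?thesis
        using kur_solution_add_periods[OF \<theta>(2) xv(2) perS perI] order_R_add_periods[OF perI xv(2)]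
        unfolding low_order_set_def by (intro CollectI exI[of _ "\<lambda>t. \<theta> t + v"]) auto
    qed
    show "0 \<le> L * M" using L0 M0 by simp
    show "infdist (b + h *\<^sub>R ?F b) ?B \<le> L * M * h\<^sup>2" if bh: "b \<in> ?B" "0 \<le> h" for b h
    proof -
      obtain \<theta> where \<theta>: "b = \<theta> 0" "kur_solution S I w \<kappa> \<theta>" "\<And>t. 0 \<le> t \<Longrightarrow> order_R I (\<theta> t) \<le> r"
        using bh(1) unfolding low_order_set_def by blast
      have "\<theta> h \<in> ?B"
        using kur_solution_shift[OF \<theta>(2) bh(2)] \<theta>(3) bh(2)
        unfolding low_order_set_def by (intro CollectI exI[of _ "\<lambda>t. \<theta> (t + h)"]) auto
      then show ?thesis
        using kur_solution_euler_error[OF \<theta>(2) L M bh(2)] \<theta>(1) by (auto intro: infdist_le2)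
    qed
    \<comment> \<open>Moving this far from the set raises \<open>R\<close> by less than
      \<open>Istar - r\<close>, so \<open>R \<le> Istar\<close> and \<open>g\<close> is nonnegative.
      The factor 2 gives the strict inequality used to pick a nearby \<open>b\<close>; the summand 1
      covers \<open>LI = 0\<close>.\<close>
    let ?\<eta> = "(Istar - r) / (2 * (LI + 1))"
    show "0 < ?\<eta>" using r LI by simp
    show "0 \<le> g x" if x: "infdist x ?B \<le> ?\<eta>" for x
    proof -
      have "infdist x ?B < (Istar - r) / (LI + 1)"
        by (rule le_less_trans[OF x]) (use r LI in \<open>simp add: divide_simps\<close>)
      then obtain b where b: "b \<in> ?B" "dist x b < (Istar - r) / (LI + 1)"
        using False cInf_lessD[of "dist x ` ?B"] by (auto simp: infdist_notempty)
      have "order_R I x - order_R I b \<le> LI * dist x b"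
        using lipschitz_onD[OF lipR, of x b] by (simp add: dist_real_def)
      also have "\<dots> \<le> (LI + 1) * dist x b" by (simp add: mult_right_mono)
      also have "\<dots> \<le> Istar - r" using b(2) LI by (simp add: field_simps)
      finally have "order_R I x \<le> Istar" using R_B[OF b(1)] by linarith
      then show ?thesis unfolding g_def using R0 pos by simp
    qed
  qed
  \<comment> \<open>Zero order parameter forces every \<open>I (x $ i)\<close> to vanish, so each
    coordinate is an odd multiple of \<open>pi\<close>: a translate of the countable
    lattice.\<close>
  moreover have "negligible {x :: real^'n::_. order_R I x = 0}"
  proof -
    have "{x :: real^'n::_. order_R I x = 0} \<subseteq> (\<lambda>v. v + (\<chi> i. - pi)) ` periods"
    proof
      fix x :: "real^'n::_" assume "x \<in> {x. order_R I x = 0}"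
      then have "I (x $ i) = 0" for i
        using I0 by (simp add: order_R_def sum_nonneg_eq_0_iff)
      have "\<exists>k :: int. (x - (\<chi> i. - pi)) $ i = 2 * pi * of_int k" for i
      proof -
        obtain k :: int where k: "- pi \<le> x $ i - 2 * pi * of_int k" "x $ i - 2 * pi * of_int k < pi"
          by (rule ex_int_shift_pi)
        have "I (x $ i - 2 * pi * of_int k) = 0"
          using periodic_of_int[OF perI, of "x $ i - 2 * pi * of_int k" k] \<open>I (x $ i) = 0\<close> by simp
        then have "\<not> - pi < x $ i - 2 * pi * of_int k"
          using k(2) Ipos[rule_format, of "x $ i - 2 * pi * of_int k"] by auto
        then have "x $ i - 2 * pi * of_int k = - pi" using k(1) by linarith
        then show ?thesis by (intro exI[of _ k]) simp
      qed
      then have "x - (\<chi> i. - pi) \<in> periods" by (simp add: periods_def)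
      then show "x \<in> (\<lambda>v. v + (\<chi> i. - pi)) ` periods" by (rule image_eqI[rotated]) simp
    qed
    then have "countable {x :: real^'n::_. order_R I x = 0}"
      using countable_periods countable_subset by blast
    then show ?thesis
      by (simp add: negligible_iff_null_sets countable_imp_null_set_lborel null_sets_completionI)
  qed
  moreover have "?B \<subseteq> {x \<in> closure ?B. 0 < g x} \<union> {x. order_R I x = 0}"
  proof
    fix b assume b: "b \<in> ?B"
    have "0 < g b" if "order_R I b \<noteq> 0"
    proof -
      have "0 < order_R I b" "0 < Istar - order_R I b" using R_B[OF b] R0[of b] that r by linarith+
      then show ?thesis using pos by (simp add: g_def)
    qed
    then show "b \<in> {x \<in> closure ?B. 0 < g x} \<union> {x. order_R I x = 0}"
      using b closure_subset[of ?B] by blast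
  qed
  ultimately show ?thesis by (meson negligible_Un negligible_subset)
qed auto

text \<open>Relabelling coordinates along a bijection is linear and maps solutions to solutions, so
  the result transfers from the well-ordered index type; a linear map between spaces of equal
  dimension preserves null sets.\<close>

lemma negligible_low_order_set:
  fixes w :: "real^'n"
  assumes perS: "\<forall>x. S (x + 2 * pi) = S x" and perI: "\<forall>x. I (x + 2 * pi) = I x"
    and lipS: "LS-lipschitz_on UNIV S" and lipI: "LI-lipschitz_on UNIV I"
    and S_diff: "\<forall>x. S differentiable (at x)" and I_diff: "\<forall>x. I differentiable (at x)"
    and S_deriv: "\<forall>x. deriv S x \<ge> c4 * (Istar - I x)"
    and I_deriv: "\<forall>x. deriv I x * S x \<ge> 0"
    and I0: "\<And>x. 0 \<le> I x" and Ipos: "\<forall>x\<in>{-pi<..<pi}. I x > 0"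
    and pos: "0 < c4" "0 < \<kappa>" and r: "r < Istar"
  shows "negligible (low_order_set S I w \<kappa> r)"
proof -
  obtain \<sigma> :: "'n \<Rightarrow> 'n enum_index" where \<sigma>: "bij \<sigma>" by (rule enum_index_bij)
  define relabel :: "real^'n \<Rightarrow> real^'n enum_index" where "relabel x = (\<chi> i. x $ inv \<sigma> i)" for x
  define unlabel :: "real^'n enum_index \<Rightarrow> real^'n" where "unlabel y = (\<chi> i. y $ \<sigma> i)" for y
  have un_re: "unlabel (relabel x) = x" for x
    using \<sigma> by (simp add: unlabel_def relabel_def vec_eq_iff bij_is_inj)
  have card: "CARD('n enum_index) = CARD('n)"
    using \<sigma> bij_betw_same_card by metis
  have R: "order_R I (relabel x) = order_R I x" for x
    unfolding order_R_def relabel_def card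
    using sum.reindex_bij_betw[OF bij_imp_bij_inv[OF \<sigma>], of "\<lambda>j. I (x $ j)"] by simp
  have F: "kur_field S I (relabel w) \<kappa> (relabel x) = relabel (kur_field S I w \<kappa> x)" for x
    by (simp add: vec_eq_iff kur_field_nth R) (simp add: relabel_def kur_field_nth)
  have lin: "linear relabel" "linear unlabel"
    by (auto intro!: linearI simp: relabel_def unlabel_def vec_eq_iff)
  have "low_order_set S I w \<kappa> r \<subseteq> unlabel ` low_order_set S I (relabel w) \<kappa> r"
  proof
    fix x assume "x \<in> low_order_set S I w \<kappa> r"
    then obtain \<theta> where \<theta>: "x = \<theta> 0" "kur_solution S I w \<kappa> \<theta>" "\<And>t. 0 \<le> t \<Longrightarrow> order_R I (\<theta> t) \<le> r"
      unfolding low_order_set_def by blast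
    have "kur_solution S I (relabel w) \<kappa> (\<lambda>t. relabel (\<theta> t))"
      using \<theta>(2) bounded_linear.has_vector_derivative[OF linear_conv_bounded_linear[THEN iffD1, OF lin(1)]]
      unfolding kur_solution_def F by blast
    then have "relabel x \<in> low_order_set S I (relabel w) \<kappa> r"
      using \<theta> unfolding low_order_set_def by (intro CollectI exI[of _ "\<lambda>t. relabel (\<theta> t)"]) (auto simp: R)
    then show "x \<in> unlabel ` low_order_set S I (relabel w) \<kappa> r"
      by (rule image_eqI[rotated]) (simp add: un_re)
  qed
  moreover have "negligible (unlabel ` low_order_set S I (relabel w) \<kappa> r)"
  proof (rule negligible_differentiable_image_negligible)
    show "negligible (low_order_set S I (relabel w) \<kappa> r)"
      using assms by (rule negligible_low_order_set_wellorder)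
    show "unlabel differentiable_on low_order_set S I (relabel w) \<kappa> r"
      using lin(2) by (rule linear_imp_differentiable_on)
  qed (simp add: card)
  ultimately show ?thesis by (rule negligible_subset[rotated])
qed

subsection \<open>Almost all initial data\<close>

theorem theorem2p14:
  fixes S I :: "real \<Rightarrow> real"
    and \<omega> :: "real ^ 'n"
    and \<alpha>0 p q c1 c2 c3 c4 Istar \<kappa> :: real
  assumes perS: "\<forall>\<theta>. S (\<theta> + 2 * pi) = S \<theta>"
    and perI: "\<forall>\<theta>. I (\<theta> + 2 * pi) = I \<theta>"
    and lipS: "\<exists>L. L-lipschitz_on UNIV S"
    and lipI: "\<exists>L. L-lipschitz_on UNIV I"
    and \<alpha>0: "0 < \<alpha>0" "\<alpha>0 < pi"
    and pq: "p \<ge> 1" "q \<ge> 1"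
    and cs: "c1 > 0" "c2 > 0" "0 < c3" "c3 \<le> 1" "c4 > 0" "Istar > 0"
    and S_right: "\<forall>\<theta>\<in>{\<alpha>0..pi}. S \<theta> \<le> - c1 * (pi - \<theta>) powr p"
    and S_left: "\<forall>\<theta>\<in>{-pi..-\<alpha>0}. S \<theta> \<ge> c1 * (\<theta> + pi) powr p"
    and I_bounds: "\<forall>\<theta>\<in>{-pi..pi}. 0 \<le> I \<theta> \<and> I \<theta> \<le> c2 * (pi - \<bar>\<theta>\<bar>) powr q"
    and I_min: "\<forall>\<theta>\<in>{-pi..pi}. \<forall>\<phi>. \<bar>\<phi>\<bar> \<le> max \<bar>\<theta>\<bar> \<alpha>0 \<longrightarrow> I \<phi> \<ge> c3 * I \<theta>"
    and S_diff: "\<forall>\<theta>. S differentiable (at \<theta>)"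
    and I_diff: "\<forall>\<theta>. I differentiable (at \<theta>)"
    and S_deriv: "\<forall>\<theta>. deriv S \<theta> \<ge> c4 * (Istar - I \<theta>)"
    and I_deriv: "\<forall>\<theta>. deriv I \<theta> * S \<theta> \<ge> 0"
    and I_pos: "\<forall>\<theta>\<in>{-pi<..<pi}. I \<theta> > 0"
    and \<kappa>: "\<kappa> > max (2 * (2 * c2) powr (p / q) / (c1 * c3) * sup_norm \<omega> / Istar powr (1 + p / q))
                   (2 / (c1 * c3 * (pi - \<alpha>0) powr p) * sup_norm \<omega> / Istar)"
  shows "AE \<Theta>0 in lborel.
           \<forall>\<theta> :: real \<Rightarrow> real ^ 'n.
             \<theta> 0 = \<Theta>0 \<and>
             (\<forall>t\<ge>0. (\<theta> has_vector_derivative kur_field S I \<omega> \<kappa> (\<theta> t)) (at t within {0..}))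
             \<longrightarrow>
             Liminf at_top (\<lambda>t. ereal (order_R I (\<theta> t))) > ereal (c3 * Istar / 2) \<and>
             (\<forall>i. Limsup at_top (\<lambda>t. ereal (\<theta> t $ i)) < \<infinity> \<and>
                  Liminf at_top (\<lambda>t. ereal (\<theta> t $ i)) > - \<infinity> \<and>
                  Limsup at_top (\<lambda>t. ereal (\<theta> t $ i)) - Liminf at_top (\<lambda>t. ereal (\<theta> t $ i))
                    < ereal (2 * pi))"
proof -
  define W where "W = sup_norm \<omega>"
  define m where "m = c3 * Istar / 2"
  \<comment> \<open>This exponent turns a lower bound on \<open>I\<close>, which controls the
    \<open>q\<close>-th power of the distance to \<open>pi\<close>, into one on the
    \<open>p\<close>-th power.\<close>
  define r where "r = p / q"
  obtain LS LI where lip: "LS-lipschitz_on UNIV S" "LI-lipschitz_on UNIV I"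
    using lipS lipI by blast
  have W: "\<bar>\<omega> $ i\<bar> \<le> W" for i
    unfolding W_def sup_norm_def by (rule Max_ge) auto
  have W0: "0 \<le> W" using W[of undefined] by linarith
  have m: "0 < m" using cs by (simp add: m_def)
  have "0 \<le> 2 / (c1 * c3 * (pi - \<alpha>0) powr p) * W / Istar" using cs W0 by simp
  then have \<kappa>0: "0 < \<kappa>" using \<kappa> by (simp add: W_def)
  \<comment> \<open>The second term of the maximum bounding \<open>\<kappa>\<close> makes
    \<open>\<alpha>0\<close> a barrier; the first does so, just below, at the level
    \<open>I = Istar / 2\<close>.\<close>
  have bar_\<alpha>0: "W < \<kappa> * m * c1 * (pi - \<alpha>0) powr p"
  proof -
    have "0 < (pi - \<alpha>0) powr p" using \<alpha>0 by simp
    then show ?thesis using \<kappa> cs unfolding W_def[symmetric] m_def by (simp add: field_simps)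
  qed
  have "W < \<kappa> * m * c1 * (Istar / 2 / c2) powr r"
  proof -
    have Y: "(Istar / 2 / c2) powr r = Istar powr r / (2 * c2) powr r"
      using cs by (simp add: powr_divide powr_mult mult.commute)
    have Z: "Istar powr (1 + r) = Istar * Istar powr r" using cs by (simp add: powr_add)
    have "0 < Istar powr r" "0 < (2 * c2) powr r" using cs by auto
    moreover have "2 * (2 * c2) powr r / (c1 * c3) * W / (Istar * Istar powr r) < \<kappa>"
      using \<kappa> Z unfolding W_def r_def by simp
    ultimately show ?thesis unfolding Y m_def using cs by (simp add: field_simps)
  qed
  \<comment> \<open>The inequality for \<open>\<kappa>\<close> is strict, so by continuity the level
    can be lowered to \<open>Istar / 2 - \<delta>\<close>. This slack later makes the bound on the
    liminf strict.\<close>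
  moreover have "((\<lambda>d. \<kappa> * m * c1 * ((Istar / 2 - d) / c2) powr r) \<longlongrightarrow>
      \<kappa> * m * c1 * ((Istar / 2 - 0) / c2) powr r) (at_right 0)"
    using cs by (intro tendsto_intros) auto
  ultimately have "\<forall>\<^sub>F d in at_right 0. W < \<kappa> * m * c1 * ((Istar / 2 - d) / c2) powr r"
    by (intro order_tendstoD) auto
  moreover have "\<forall>\<^sub>F d in at_right 0. d < Istar / 2"
    using cs unfolding eventually_at_right_field by (intro exI[of _ "Istar / 2"]) auto
  moreover have "\<forall>\<^sub>F d :: real in at_right 0. 0 < d" by (rule eventually_at_right_less)
  ultimately have "\<forall>\<^sub>F d in at_right 0. 0 < d \<and> d < Istar / 2 \<and> W < \<kappa> * m * c1 * ((Istar / 2 - d) / c2) powr r"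
    by eventually_elim auto
  then obtain \<delta> where \<delta>: "0 < \<delta>" "\<delta> < Istar / 2" "W < \<kappa> * m * c1 * ((Istar / 2 - \<delta>) / c2) powr r"
    using eventually_happens' trivial_limit_at_right_real by blast
  have I0: "0 \<le> I x" for x
  proof -
    obtain k :: int where "- pi \<le> x - 2 * pi * of_int k" "x - 2 * pi * of_int k < pi"
      by (rule ex_int_shift_pi)
    then have "0 \<le> I (x - 2 * pi * of_int k)" using I_bounds by auto
    then show ?thesis using periodic_of_int[OF perI, of "x - 2 * pi * of_int k" k] by simp
  qed
  \<comment> \<open>While \<open>R \<ge> m\<close>, the coupling at angle \<open>\<beta>\<close> on
    either side of a multiple of \<open>2 * pi\<close> outweighs every natural frequency and points
    inwards.\<close>
  have barrier: "\<omega> $ i + \<kappa> * R * S (2 * pi * of_int k + \<beta>) < 0" "0 < \<omega> $ i + \<kappa> * R * S (2 * pi * of_int k - \<beta>)"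
    if \<beta>: "\<alpha>0 \<le> \<beta>" "\<beta> < pi" "W < \<kappa> * m * c1 * (pi - \<beta>) powr p" and R: "m \<le> R" for \<beta> i R and k :: int
  proof -
    let ?P = "c1 * (pi - \<beta>) powr p"
    have P: "0 \<le> ?P" using cs by simp
    have per: "S (2 * pi * of_int k + \<beta>) = S \<beta>" "S (2 * pi * of_int k - \<beta>) = S (- \<beta>)"
      using periodic_of_int[OF perS, of \<beta> k] periodic_of_int[OF perS, of "- \<beta>" k] by (simp_all add: add.commute)
    have S: "S \<beta> \<le> - ?P" "?P \<le> S (- \<beta>)"
      using S_right[rule_format, of \<beta>] S_left[rule_format, of "- \<beta>"] \<beta> by simp_all
    have "\<kappa> * m * ?P \<le> \<kappa> * R * ?P" using R \<kappa>0 P by (intro mult_right_mono mult_left_mono) auto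
    then have "W < \<kappa> * R * ?P" using \<beta>(3) by (simp add: mult.assoc)
    moreover have "0 \<le> \<kappa> * R" using R m \<kappa>0 by simp
    then have "\<kappa> * R * S \<beta> \<le> \<kappa> * R * (- ?P)" "\<kappa> * R * ?P \<le> \<kappa> * R * S (- \<beta>)"
      using S by (auto simp only: intro!: mult_left_mono)
    ultimately show "\<omega> $ i + \<kappa> * R * S (2 * pi * of_int k + \<beta>) < 0" "0 < \<omega> $ i + \<kappa> * R * S (2 * pi * of_int k - \<beta>)"
      using W[of i] unfolding per by (auto simp: abs_le_iff)
  qed
  \<comment> \<open>Inverting the upper bound on \<open>I\<close>: a phase with \<open>I\<close>
    above the lowered level stays far enough from \<open>pi\<close> for its own modulus, or
    \<open>\<alpha>0\<close> if larger, to serve as a barrier.\<close>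
  have bar_level: "W < \<kappa> * m * c1 * (pi - max \<bar>\<phi>\<bar> \<alpha>0) powr p \<and> max \<bar>\<phi>\<bar> \<alpha>0 < pi"
    if \<phi>: "\<phi> \<in> {-pi..pi}" "Istar / 2 - \<delta> \<le> I \<phi>" for \<phi>
  proof -
    define y where "y = pi - \<bar>\<phi>\<bar>"
    have y0: "0 \<le> y" using \<phi>(1) by (auto simp: y_def)
    have yq: "(Istar / 2 - \<delta>) / c2 \<le> y powr q"
      using I_bounds \<phi> cs unfolding y_def by (force simp: divide_simps mult.commute)
    have pos: "0 < (Istar / 2 - \<delta>) / c2" using \<delta> cs by simp
    have "y \<noteq> 0" using yq pos by auto
    then have y: "0 < y" using y0 by simp
    have "((Istar / 2 - \<delta>) / c2) powr r \<le> (y powr q) powr r"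
      using yq pos pq by (intro powr_mono2) (auto simp: r_def)
    also have "\<dots> = y powr p" using pq by (simp add: powr_powr r_def)
    finally have "\<kappa> * m * c1 * ((Istar / 2 - \<delta>) / c2) powr r \<le> \<kappa> * m * c1 * y powr p"
      using \<kappa>0 m cs by (intro mult_left_mono) auto
    then have "W < \<kappa> * m * c1 * y powr p" using \<delta>(3) by linarith
    then show ?thesis using bar_\<alpha>0 y \<alpha>0 unfolding y_def by (auto simp: max_def)
  qed
  have "negligible (low_order_set S I \<omega> \<kappa> (Istar - \<delta> / 2))"
    using \<delta>(1) by (intro negligible_low_order_set[OF perS perI lip S_diff I_diff S_deriv I_deriv I0 I_pos]) (auto simp: cs \<kappa>0)
  then have "AE x in lebesgue. x \<notin> low_order_set S I \<omega> \<kappa> (Istar - \<delta> / 2)"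
    by (intro AE_not_in) (simp add: negligible_iff_null_sets)
  then have "AE x in lborel. x \<notin> low_order_set S I \<omega> \<kappa> (Istar - \<delta> / 2)"
    by (simp add: AE_completion_iff)
  then show ?thesis
  proof (rule AE_mp, intro AE_I2 impI allI)
    fix x :: "real^'n" and \<theta> :: "real \<Rightarrow> real^'n"
    assume x: "x \<notin> low_order_set S I \<omega> \<kappa> (Istar - \<delta> / 2)"
      and \<theta>: "\<theta> 0 = x \<and> (\<forall>t\<ge>0. (\<theta> has_vector_derivative kur_field S I \<omega> \<kappa> (\<theta> t)) (at t within {0..}))"
    let ?R = "\<lambda>t. order_R I (\<theta> t)"
    obtain t0 where t0: "0 \<le> t0" "Istar - \<delta> / 2 < ?R t0"
      using x \<theta> unfolding low_order_set_def kur_solution_def by (auto simp: not_le)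
    have der: "((\<lambda>t. \<theta> t $ i) has_real_derivative \<omega> $ i + \<kappa> * ?R t * S (\<theta> t $ i)) (at t within {t1..})"
      if "0 \<le> t1" "t1 \<le> t" for t t1 i
    proof -
      have "(\<theta> has_vector_derivative kur_field S I \<omega> \<kappa> (\<theta> t)) (at t within {t1..})"
        by (rule has_vector_derivative_within_subset[where S = "{0..}"]) (use \<theta> that in auto)
      then show ?thesis
        using bounded_linear.has_vector_derivative[OF bounded_linear_vec_nth[of i]]
        by (fastforce simp: has_real_derivative_iff_has_vector_derivative kur_field_nth)
    qed
    obtain k :: "'n \<Rightarrow> int" where k: "\<And>i. \<theta> t0 $ i - 2 * pi * of_int (k i) \<in> {-pi..pi}"
    proof -
      have "\<exists>k :: int. \<theta> t0 $ i - 2 * pi * of_int k \<in> {-pi..pi}" for i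
        by (rule ex_int_shift_pi[of "\<theta> t0 $ i"]) force
      then show ?thesis using that by metis
    qed
    define \<phi> where "\<phi> i = \<theta> t0 $ i - 2 * pi * of_int (k i)" for i
    \<comment> \<open>Each oscillator in \<open>A\<close> gets a box reaching to its own position at
      time \<open>t0\<close>. The maximum with \<open>\<alpha>0\<close> puts the walls where the
      sign bounds on \<open>S\<close> hold and matches \<open>I_min\<close>.\<close>
    define \<beta> where "\<beta> i = max \<bar>\<phi> i\<bar> \<alpha>0" for i
    define A where "A = {i. Istar / 2 - \<delta> \<le> I (\<phi> i)}"
    have \<phi>: "\<phi> i \<in> {-pi..pi}" for i using k by (simp add: \<phi>_def)
    have I_\<phi>: "I (\<phi> i) = I (\<theta> t0 $ i)" for i
      using periodic_of_int[OF perI, of "\<phi> i" "k i"] by (simp add: \<phi>_def)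
    \<comment> \<open>Oscillators outside \<open>A\<close> average less than
      \<open>Istar / 2 - \<delta>\<close>; subtracting this from \<open>Istar - \<delta> / 2\<close>
      leaves \<open>Istar / 2 + \<delta> / 2\<close> for those in \<open>A\<close>, and
      \<open>I_min\<close> costs the factor \<open>c3\<close>.\<close>
    define m' where "m' = c3 * (Istar / 2 + \<delta> / 2)"
    have m': "m < m'" using \<delta> cs by (simp add: m_def m'_def algebra_simps)
    have A_sum: "real CARD('n) * (Istar / 2 + \<delta> / 2) \<le> (\<Sum>i\<in>A. I (\<phi> i))"
    proof -
      have "real CARD('n) * (Istar - \<delta> / 2) \<le> (\<Sum>i\<in>UNIV. I (\<phi> i))"
        using t0(2) unfolding I_\<phi> order_R_def by (simp add: field_simps)
      also have "\<dots> = (\<Sum>i\<in>A. I (\<phi> i)) + (\<Sum>i\<in>-A. I (\<phi> i))"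
        by (simp add: sum.subset_diff[of A UNIV] Compl_eq_Diff_UNIV add.commute)
      also have "(\<Sum>i\<in>-A. I (\<phi> i)) \<le> (\<Sum>i\<in>-A. Istar / 2 - \<delta>)"
        by (intro sum_mono) (auto simp: A_def)
      also have "\<dots> \<le> (\<Sum>i\<in>(UNIV :: 'n set). Istar / 2 - \<delta>)"
        using \<delta> by (intro sum_mono2) auto
      finally show ?thesis by (simp add: algebra_simps)
    qed
    have R_ge: "m' \<le> ?R t" if "\<And>i. i \<in> A \<Longrightarrow> \<theta> t $ i \<in> {2 * pi * of_int (k i) - \<beta> i..2 * pi * of_int (k i) + \<beta> i}" for t
    proof -
      have "c3 * I (\<phi> i) \<le> I (\<theta> t $ i)" if "i \<in> A" for i
      proof -
        have "\<bar>\<theta> t $ i - 2 * pi * of_int (k i)\<bar> \<le> max \<bar>\<phi> i\<bar> \<alpha>0"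
          using \<open>\<And>i. i \<in> A \<Longrightarrow> _\<close>[OF that] by (auto simp: \<beta>_def[symmetric] abs_le_iff)
        then have "c3 * I (\<phi> i) \<le> I (\<theta> t $ i - 2 * pi * of_int (k i))" using I_min \<phi> by blast
        then show ?thesis
          using periodic_of_int[OF perI, of "\<theta> t $ i - 2 * pi * of_int (k i)" "k i"] by simp
      qed
      then have "c3 * (\<Sum>i\<in>A. I (\<phi> i)) \<le> (\<Sum>i\<in>A. I (\<theta> t $ i))"
        by (simp add: sum_distrib_left sum_mono)
      also have "\<dots> \<le> (\<Sum>i\<in>UNIV. I (\<theta> t $ i))" using I0 by (intro sum_mono2) auto
      finally have "c3 * (real CARD('n) * (Istar / 2 + \<delta> / 2)) \<le> (\<Sum>i\<in>UNIV. I (\<theta> t $ i))"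
        using mult_left_mono[OF A_sum, of c3] cs by linarith
      then show ?thesis unfolding order_R_def m'_def by (simp add: field_simps)
    qed
    \<comment> \<open>No circularity arises: \<open>R_ge\<close> derives the bound on
      \<open>R\<close> at a time from the boxes at that same time, as \<open>invariant_box\<close>
      permits.\<close>
    have trapped: "\<theta> t $ i \<in> {2 * pi * of_int (k i) - \<beta> i..2 * pi * of_int (k i) + \<beta> i}"
      if "t0 \<le> t" "i \<in> A" for t i
    proof (rule invariant_box[where x = "\<lambda>t i. \<theta> t $ i" and A = A and a = t0
          and D = "\<lambda>t i. \<omega> $ i + \<kappa> * ?R t * S (\<theta> t $ i)", OF _ der[OF t0(1)] _ _ that])
      show "\<theta> t0 $ i \<in> {2 * pi * of_int (k i) - \<beta> i..2 * pi * of_int (k i) + \<beta> i}" for i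
        by (auto simp: \<beta>_def \<phi>_def)
      fix t i assume "t0 \<le> t" and box: "\<And>i. i \<in> A \<Longrightarrow> \<theta> t $ i \<in> {2 * pi * of_int (k i) - \<beta> i..2 * pi * of_int (k i) + \<beta> i}"
        and i: "i \<in> A"
      have "m \<le> ?R t" using R_ge[OF box] m' by linarith
      moreover have "W < \<kappa> * m * c1 * (pi - \<beta> i) powr p" "\<beta> i < pi" "\<alpha>0 \<le> \<beta> i"
        using bar_level[OF \<phi>] i by (auto simp: A_def \<beta>_def)
      ultimately show "(\<theta> t $ i = 2 * pi * of_int (k i) + \<beta> i \<longrightarrow> \<omega> $ i + \<kappa> * ?R t * S (\<theta> t $ i) < 0) \<and>
          (\<theta> t $ i = 2 * pi * of_int (k i) - \<beta> i \<longrightarrow> 0 < \<omega> $ i + \<kappa> * ?R t * S (\<theta> t $ i))"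
        using barrier by simp
    qed auto
    have R_ge_m': "m' \<le> ?R t" if "t0 \<le> t" for t using R_ge trapped that by blast
    have "ereal m' \<le> Liminf at_top (\<lambda>t. ereal (?R t))"
      by (intro Liminf_bounded eventually_mono[OF eventually_ge_at_top[of t0]]) (simp add: R_ge_m')
    then have a: "ereal (c3 * Istar / 2) < Liminf at_top (\<lambda>t. ereal (?R t))"
      using m' unfolding m_def by (meson less_ereal.simps(1) less_le_trans)
    \<comment> \<open>Either the phase enters an arc of half-width \<open>\<alpha>0\<close> around a
      multiple of \<open>2 * pi\<close> and is trapped there, or it never does and stays in one gap
      between consecutive arcs. Both have length below \<open>2 * pi\<close>.\<close>
    have window: "\<exists>l u. u - l < 2 * pi \<and> (\<forall>\<^sub>F t in at_top. \<theta> t $ i \<in> {l..u})" for i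
    proof (cases "\<exists>t1\<ge>t0. \<exists>n :: int. \<bar>\<theta> t1 $ i - 2 * pi * of_int n\<bar> \<le> \<alpha>0")
      case True
      then obtain t1 and n :: int where t1: "t0 \<le> t1" and n: "\<bar>\<theta> t1 $ i - 2 * pi * of_int n\<bar> \<le> \<alpha>0" by blast
      have t1_0: "0 \<le> t1" using t0(1) t1 by simp
      have "\<theta> t $ i \<in> {2 * pi * of_int n - \<alpha>0..2 * pi * of_int n + \<alpha>0}" if "t1 \<le> t" for t
      proof (rule invariant_box[where x = "\<lambda>t i. \<theta> t $ i" and A = "{i}" and a = t1 and j = i
            and D = "\<lambda>t i. \<omega> $ i + \<kappa> * ?R t * S (\<theta> t $ i)", OF _ der[OF t1_0] _ _ that])
        show "\<theta> t1 $ j \<in> {2 * pi * of_int n - \<alpha>0..2 * pi * of_int n + \<alpha>0}" if "j \<in> {i}" for j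
          using n that by (auto simp: abs_le_iff)
        fix t j assume "t1 \<le> t" "j \<in> {i}"
        then have "m \<le> ?R t" using R_ge_m'[of t] t1 m' by linarith
        then show "(\<theta> t $ j = 2 * pi * of_int n + \<alpha>0 \<longrightarrow> \<omega> $ j + \<kappa> * ?R t * S (\<theta> t $ j) < 0) \<and>
          (\<theta> t $ j = 2 * pi * of_int n - \<alpha>0 \<longrightarrow> 0 < \<omega> $ j + \<kappa> * ?R t * S (\<theta> t $ j))"
          using barrier \<alpha>0 bar_\<alpha>0 by simp
      qed auto
      then have "\<forall>\<^sub>F t in at_top. \<theta> t $ i \<in> {2 * pi * of_int n - \<alpha>0..2 * pi * of_int n + \<alpha>0}"
        by (intro eventually_mono[OF eventually_ge_at_top[of t1]])
      then show ?thesis using \<alpha>0 by (intro exI[of _ "2 * pi * of_int n - \<alpha>0"] exI[of _ "2 * pi * of_int n + \<alpha>0"]) simp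
    next
      case False
      then have avoid: "\<alpha>0 < \<bar>\<theta> t $ i - 2 * pi * of_int n\<bar>" if "t0 \<le> t" for t and n :: int
        using that by (meson not_le)
      have cont: "continuous_on {t0..} (\<lambda>t. \<theta> t $ i)"
        using der[OF t0(1)] by (intro DERIV_continuous_on) auto
      \<comment> \<open>The shift by \<open>pi\<close> selects \<open>n\<close> so that the phase
        lies between \<open>2 * pi * n\<close> and \<open>2 * pi * (n + 1)\<close>, the centres of
        the two neighbouring arcs.\<close>
      obtain n :: int where n: "- pi \<le> \<theta> t0 $ i - pi - 2 * pi * of_int n" "\<theta> t0 $ i - pi - 2 * pi * of_int n < pi"
        by (rule ex_int_shift_pi)
      let ?l = "2 * pi * of_int n + \<alpha>0" and ?u = "2 * pi * of_int (n + 1) - \<alpha>0"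
      have start: "?l < \<theta> t0 $ i" "\<theta> t0 $ i < ?u"
        using avoid[of t0 n] avoid[of t0 "n + 1"] n by (auto simp: algebra_simps abs_if split: if_splits)
      have conn: "connected ((\<lambda>t. \<theta> t $ i) ` {t0..})"
        using cont by (intro connected_continuous_image) auto
      \<comment> \<open>Leaving the gap would, by the intermediate value property, mean hitting an
        endpoint, which lies at distance exactly \<open>\<alpha>0\<close> from a centre.\<close>
      have "?l < \<theta> t $ i \<and> \<theta> t $ i < ?u" if t: "t0 \<le> t" for t
      proof (rule ccontr)
        assume out: "\<not> (?l < \<theta> t $ i \<and> \<theta> t $ i < ?u)"
        have "?l \<in> (\<lambda>t. \<theta> t $ i) ` {t0..} \<or> ?u \<in> (\<lambda>t. \<theta> t $ i) ` {t0..}"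
          using out start t connectedD_interval[OF conn, of "\<theta> t $ i" "\<theta> t0 $ i" ?l]
            connectedD_interval[OF conn, of "\<theta> t0 $ i" "\<theta> t $ i" ?u] by force
        then obtain s where "t0 \<le> s" "\<theta> s $ i = ?l \<or> \<theta> s $ i = ?u" by auto
        then show False using avoid[of s n] avoid[of s "n + 1"] \<alpha>0 by auto
      qed
      then have "\<forall>\<^sub>F t in at_top. \<theta> t $ i \<in> {?l..?u}"
        by (intro eventually_mono[OF eventually_ge_at_top[of t0]]) (simp add: less_imp_le)
      moreover have "?u - ?l < 2 * pi" using \<alpha>0 by (simp add: algebra_simps)
      ultimately show ?thesis by blast
    qed
    have b: "Limsup at_top (\<lambda>t. ereal (\<theta> t $ i)) < \<infinity> \<and>
        Liminf at_top (\<lambda>t. ereal (\<theta> t $ i)) > - \<infinity> \<and>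
        Limsup at_top (\<lambda>t. ereal (\<theta> t $ i)) - Liminf at_top (\<lambda>t. ereal (\<theta> t $ i)) < ereal (2 * pi)" for i
    proof -
      obtain l u where lu: "u - l < 2 * pi" and ev: "\<forall>\<^sub>F t in at_top. \<theta> t $ i \<in> {l..u}"
        using window by blast
      have sup: "Limsup at_top (\<lambda>t. ereal (\<theta> t $ i)) \<le> ereal u"
        by (intro Limsup_bounded eventually_mono[OF ev]) simp
      have inf: "ereal l \<le> Liminf at_top (\<lambda>t. ereal (\<theta> t $ i))"
        by (intro Liminf_bounded eventually_mono[OF ev]) simp
      have "Limsup at_top (\<lambda>t. ereal (\<theta> t $ i)) - Liminf at_top (\<lambda>t. ereal (\<theta> t $ i)) \<le> ereal u - ereal l"
        using sup inf by (rule ereal_minus_mono)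
      also have "\<dots> < ereal (2 * pi)" using lu by simp
      moreover have "ereal u < \<infinity>" "- \<infinity> < ereal l" by simp_all
      ultimately show ?thesis using sup inf by (meson le_less_trans less_le_trans)
    qed
    show "Liminf at_top (\<lambda>t. ereal (?R t)) > ereal (c3 * Istar / 2) \<and>
        (\<forall>i. Limsup at_top (\<lambda>t. ereal (\<theta> t $ i)) < \<infinity> \<and>
          Liminf at_top (\<lambda>t. ereal (\<theta> t $ i)) > - \<infinity> \<and>
          Limsup at_top (\<lambda>t. ereal (\<theta> t $ i)) - Liminf at_top (\<lambda>t. ereal (\<theta> t $ i)) < ereal (2 * pi))"
      using a b by blast
  qed
qed

end
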